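(* Let $k$ be a field (of arbitrary characteristic), $R=k[x_1,\dots,x_n]$, and let $f\in R$ be a polynomial of degree $d$. Then the length of $R_f$ in the category of $D(R,k)$-modules is at most $(d+1)^n$, and the length of $H^1_f(R)$ in the category of $D(R,k)$-modules is at most $(d+1)^n-1$.
   Context: $D(R,k)$ denotes the ring of $k$-linear differential operators on $R$; it is generated over $R$ by the operators $\frac{1}{t!}\frac{\partial^t}{\partial x_i^t}$, $t\ge 0$, $1\le i\le n$. $R_f$ and $H^1_f(R)=R_f/R$ carry natural $D(R,k)$-module structures. *)

theory Defs
  imports "HOL-Library.Poly_Mapping" "HOL-Library.Extended_Nat"
begin

text \<open>Polynomials in the variables x_0, x_1, ... over a field: finitely supported
  maps from monomials (exponent vectors) to coefficients. R = k[x_0..x_(n-1)] is the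
  carrier polys n.\<close>

type_synonym 'k mpoly = "(nat \<Rightarrow>\<^sub>0 nat) \<Rightarrow>\<^sub>0 'k"

definition polys :: "nat \<Rightarrow> 'k::field mpoly set" where
  "polys n = {p. \<forall>m\<in>Poly_Mapping.keys p. Poly_Mapping.keys m \<subseteq> {..<n}}"

text \<open>Total degree (the zero polynomial gets degree 0).\<close>
definition total_deg :: "'k::field mpoly \<Rightarrow> nat" where
  "total_deg p = Max (insert 0 ((\<lambda>m. sum (Poly_Mapping.lookup m) (Poly_Mapping.keys m)) ` Poly_Mapping.keys p))"

text \<open>Divided partial derivative (1/t!) d^t/dx_i^t :
  x^m maps to (m_i choose t) x^(m - t e_i).\<close>
definition dpart :: "nat \<Rightarrow> nat \<Rightarrow> 'k::field mpoly \<Rightarrow> 'k mpoly" where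
  "dpart i t p = (\<Sum>m\<in>Poly_Mapping.keys p. Poly_Mapping.single (m - Poly_Mapping.single i t)
                                 (of_nat (Poly_Mapping.lookup m i choose t) * Poly_Mapping.lookup p m))"

text \<open>Localization R_f: elements g/f^s are represented by pairs (g,s) with g in R.\<close>
definition loc_eq :: "'k::field mpoly \<Rightarrow> 'k mpoly \<times> nat \<Rightarrow> 'k mpoly \<times> nat \<Rightarrow> bool" where
  "loc_eq f p q \<longleftrightarrow> (\<exists>N. f ^ N * (fst p * f ^ snd q - fst q * f ^ snd p) = 0)"

text \<open>H^1_f(R) = R_f / R: two representatives are identified iff their difference lies in R.\<close>
definition hloc_eq :: "'k::field mpoly \<Rightarrow> nat \<Rightarrow> 'k mpoly \<times> nat \<Rightarrow> 'k mpoly \<times> nat \<Rightarrow> bool" where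
  "hloc_eq f n p q \<longleftrightarrow>
     (\<exists>a\<in>polys n. loc_eq f (fst p * f ^ snd q - fst q * f ^ snd p, snd p + snd q) (a, 0))"

definition loc_add :: "'k::field mpoly \<Rightarrow> 'k mpoly \<times> nat \<Rightarrow> 'k mpoly \<times> nat \<Rightarrow> 'k mpoly \<times> nat" where
  "loc_add f p q = (fst p * f ^ snd q + fst q * f ^ snd p, snd p + snd q)"

text \<open>The natural action of the divided derivative on R_f, obtained from the Leibniz rule:
  for h = g/F (F = f^s), P_t = F^(t+1) * d^[t] h satisfies
  P_t = F^t d^[t] g - sum_(j=1..t) d^[j] F * F^(j-1) * P_(t-j).\<close>
function dloc_num :: "nat \<Rightarrow> 'k::field mpoly \<Rightarrow> 'k mpoly \<Rightarrow> nat \<Rightarrow> 'k mpoly" where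
  "dloc_num i F g t = F ^ t * dpart i t g
     - (\<Sum>j\<in>{1..t}. dpart i j F * F ^ (j - 1) * dloc_num i F g (t - j))"
  by pat_completeness auto
termination by (relation "measure (\<lambda>(i, F, g, t). t)") auto

definition dact :: "'k::field mpoly \<Rightarrow> nat \<Rightarrow> nat \<Rightarrow> 'k mpoly \<times> nat \<Rightarrow> 'k mpoly \<times> nat" where
  "dact f i t p = (dloc_num i (f ^ snd p) (fst p) t, snd p * (t + 1))"

text \<open>D(R,k)-submodules of the module of representatives modulo the equivalence E
  (E = loc_eq f for R_f, E = hloc_eq f n for H^1_f(R)), as saturated sets of representatives.
  D(R,k) is generated over R by the divided derivatives, so a D(R,k)-submodule is an
  additive subgroup closed under multiplication by R and under all dact f i t, i < n.\<close>
definition dsubmod ::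
  "('k::field mpoly \<times> nat \<Rightarrow> 'k mpoly \<times> nat \<Rightarrow> bool) \<Rightarrow> 'k mpoly \<Rightarrow> nat
     \<Rightarrow> ('k mpoly \<times> nat) set \<Rightarrow> bool" where
  "dsubmod E f n M \<longleftrightarrow>
     M \<subseteq> polys n \<times> UNIV \<and>
     (\<forall>p\<in>M. \<forall>q\<in>polys n \<times> UNIV. E p q \<longrightarrow> q \<in> M) \<and>
     (0, 0) \<in> M \<and>
     (\<forall>p\<in>M. \<forall>q\<in>M. loc_add f p q \<in> M) \<and>
     (\<forall>a\<in>polys n. \<forall>p\<in>M. (a * fst p, snd p) \<in> M) \<and>
     (\<forall>i<n. \<forall>t. \<forall>p\<in>M. dact f i t p \<in> M)"

definition dlength ::
  "('k::field mpoly \<times> nat \<Rightarrow> 'k mpoly \<times> nat \<Rightarrow> bool) \<Rightarrow> 'k mpoly \<Rightarrow> nat \<Rightarrow> enat" where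
  "dlength E f n = Sup {enat l | l. \<exists>N. (\<forall>j\<le>l. dsubmod E f n (N j)) \<and>
                                          (\<forall>j<l. N j \<subset> N (Suc j))}"

end

theory Submission
  imports Defs "HOL-Computational_Algebra.Polynomial_Factorial"
    "HOL-Computational_Algebra.Formal_Power_Series" "HOL-Real_Asymp.Real_Asymp"
begin

text \<open>
  View \<open>R\<^sub>f\<close> inside the fraction field of the polynomial ring. For \<open>d = deg f\<close> the subspaces
  \<open>V\<^sub>j = {g / f^j. deg g \<le> j (d + 1)}\<close> satisfy \<open>x\<^sub>i V\<^sub>j \<subseteq> V\<^sub>j\<^sub>+\<^sub>1\<close> and \<open>\<partial>\<^sub>i\<^sup>[\<^sup>t\<^sup>] V\<^sub>j \<subseteq> V\<^sub>j\<^sub>+\<^sub>t\<close>, and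
  \<open>dim V\<^sub>j \<le> (d + 1)^n N(j)\<close>, where \<open>N(j)\<close> counts the monomials of degree at most \<open>j\<close>.

  Every proper inclusion \<open>A \<subset> B\<close> of D-submodules contributes at least \<open>N(j - c)\<close> to \<open>dim V\<^sub>j\<close>.
  Choose \<open>w \<in> B - A\<close> whose annihilator \<open>P\<close> modulo \<open>A\<close> is maximal, hence prime. Let \<open>s\<^sub>i\<close> be the
  least order \<open>r\<close> such that \<open>\<partial>\<^sub>i\<^sup>[\<^sup>r\<^sup>]\<close> moves some \<open>g\<^sub>i \<in> P \<inter> k[x\<^sub>0,\<dots>,x\<^sub>i]\<close> out of \<open>P\<close>.
  Then the elements obtained from \<open>w\<close> by multiplying with \<open>x\<^sup>r\<close>, where \<open>r\<^sub>i = b\<^sub>i mod s\<^sub>i\<close>, and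
  differentiating \<open>b\<^sub>i - r\<^sub>i\<close> times in \<open>x\<^sub>i\<close>, for \<open>b\<close> in \<open>\<nat>\<^sup>n\<close>, are linearly independent modulo \<open>A\<close>:
  powers of the \<open>g\<^sub>i\<close> strip off the derivatives of a leading term one variable at a time, and
  a polynomial in \<open>P\<close> all of whose exponents satisfy \<open>r\<^sub>i < s\<^sub>i\<close> vanishes.

  Hence a chain of length \<open>l\<close> gives \<open>l N(j) \<le> (d + 1)^n N(j + c)\<close> for all \<open>j\<close>, and
  \<open>l \<le> (d + 1)^n\<close> since \<open>N\<close> grows polynomially. A chain in \<open>R\<^sub>f / R\<close> lifts to a chain in \<open>R\<^sub>f\<close>
  whose members contain \<open>1\<close>, so that \<open>0\<close> can be put in front of it.
\<close>

section \<open>Monomials and polynomials of bounded degree\<close>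

abbreviation "lookup \<equiv> Poly_Mapping.lookup"
abbreviation "keys \<equiv> Poly_Mapping.keys"
abbreviation "single \<equiv> Poly_Mapping.single"

type_synonym monomial = "nat \<Rightarrow>\<^sub>0 nat"

definition monomial_degree :: "('a \<Rightarrow>\<^sub>0 nat) \<Rightarrow> nat" where
  "monomial_degree m = sum (lookup m) (keys m)"

lemma monomial_degree_superset:
  "finite S \<Longrightarrow> keys m \<subseteq> S \<Longrightarrow> monomial_degree m = sum (lookup m) S"
  unfolding monomial_degree_def by (rule sum.mono_neutral_left) (auto simp: in_keys_iff)

lemma monomial_degree_add: "monomial_degree (a + b) = monomial_degree a + monomial_degree b"
proof -
  have "monomial_degree (a + b) = sum (lookup (a + b)) (keys a \<union> keys b)"
    by (rule monomial_degree_superset) (auto simp: keys_add)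
  also have "\<dots> = sum (lookup a) (keys a \<union> keys b) + sum (lookup b) (keys a \<union> keys b)"
    by (simp add: lookup_add sum.distrib)
  also have "\<dots> = monomial_degree a + monomial_degree b"
    by (simp add: monomial_degree_superset [of "keys a \<union> keys b"])
  finally show ?thesis .
qed

lemma monomial_degree_zero [simp]: "monomial_degree 0 = 0"
  by (simp add: monomial_degree_def)

lemma lookup_le_monomial_degree: "lookup m i \<le> monomial_degree m"
  unfolding monomial_degree_def
  by (cases "i \<in> keys m") (auto simp: in_keys_iff intro: member_le_sum)

definition monomials :: "nat \<Rightarrow> monomial set" where
  "monomials n = {m. keys m \<subseteq> {..<n}}"

lemma monomials_iff: "m \<in> monomials n \<longleftrightarrow> (\<forall>i\<ge>n. lookup m i = 0)"
  unfolding monomials_def by (auto simp: in_keys_iff subset_iff) (metis linorder_not_le less_irrefl)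

lemma monomials_eqI:
  assumes "a \<in> monomials n" "b \<in> monomials n" "\<And>i. i < n \<Longrightarrow> lookup a i = lookup b i"
  shows "a = b"
  using assms by (intro poly_mapping_eqI) (metis monomials_iff linorder_not_le)

lemma zero_in_monomials [simp]: "0 \<in> monomials n"
  by (simp add: monomials_def)

lemma monomials_add: "a \<in> monomials n \<Longrightarrow> b \<in> monomials n \<Longrightarrow> a + b \<in> monomials n"
  by (auto simp: monomials_iff lookup_add)

lemma monomial_degree_monomials:
  "m \<in> monomials n \<Longrightarrow> monomial_degree m = (\<Sum>i<n. lookup m i)"
  by (rule monomial_degree_superset) (auto simp: monomials_def)

definition div_monomial :: "monomial \<Rightarrow> (nat \<Rightarrow> nat) \<Rightarrow> monomial" where
  "div_monomial m s = Poly_Mapping.mapp (\<lambda>i a. a div s i) m"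

definition mod_monomial :: "monomial \<Rightarrow> (nat \<Rightarrow> nat) \<Rightarrow> monomial" where
  "mod_monomial m s = Poly_Mapping.mapp (\<lambda>i a. a mod s i) m"

lemma lookup_div_monomial [simp]: "lookup (div_monomial m s) i = lookup m i div s i"
  by (simp add: div_monomial_def lookup_mapp when_def in_keys_iff)

lemma lookup_mod_monomial [simp]: "lookup (mod_monomial m s) i = lookup m i mod s i"
  by (simp add: mod_monomial_def lookup_mapp when_def in_keys_iff)

lemma div_monomial_in_monomials: "m \<in> monomials n \<Longrightarrow> div_monomial m s \<in> monomials n"
  and mod_monomial_in_monomials: "m \<in> monomials n \<Longrightarrow> mod_monomial m s \<in> monomials n"
  by (simp_all add: monomials_iff)

lemma monomial_eqI_div_mod:
  assumes "div_monomial a s = div_monomial b s" "mod_monomial a s = mod_monomial b s"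
  shows "a = b"
  using assms
  by (intro poly_mapping_eqI) (metis div_mult_mod_eq lookup_div_monomial lookup_mod_monomial)

definition monomials_upto :: "nat \<Rightarrow> nat \<Rightarrow> monomial set" where
  "monomials_upto n e = {m \<in> monomials n. monomial_degree m \<le> e}"

lemma zero_in_monomials_upto [simp]: "0 \<in> monomials_upto n e"
  by (simp add: monomials_upto_def)

lemma monomials_upto_add:
  "a \<in> monomials_upto n e \<Longrightarrow> b \<in> monomials_upto n e' \<Longrightarrow> a + b \<in> monomials_upto n (e + e')"
  by (auto simp: monomials_upto_def monomial_degree_add intro: monomials_add)

lemma monomials_upto_mono: "e \<le> e' \<Longrightarrow> monomials_upto n e \<subseteq> monomials_upto n e'"
  by (auto simp: monomials_upto_def)

lemma polys_iff: "p \<in> polys n \<longleftrightarrow> keys p \<subseteq> monomials n"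
  by (auto simp: polys_def monomials_def)

definition polys_upto :: "nat \<Rightarrow> nat \<Rightarrow> 'k::field mpoly set" where
  "polys_upto n e = {p. keys p \<subseteq> monomials_upto n e}"

lemma polys_upto_total_deg: "p \<in> polys n \<Longrightarrow> p \<in> polys_upto n (total_deg p)"
  unfolding polys_upto_def monomials_upto_def polys_iff total_deg_def monomial_degree_def
  by (auto intro!: Max_ge)

lemma polys_iff_polys_upto: "p \<in> polys n \<longleftrightarrow> (\<exists>e. p \<in> polys_upto n e)"
proof
  assume "\<exists>e. p \<in> polys_upto n e"
  then show "p \<in> polys n"
    by (auto simp: polys_upto_def monomials_upto_def polys_iff)
qed (use polys_upto_total_deg in blast)

lemma polys_upto_mono: "p \<in> polys_upto n e \<Longrightarrow> e \<le> e' \<Longrightarrow> p \<in> polys_upto n e'"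
  unfolding polys_upto_def using monomials_upto_mono by blast

lemma polys_upto_zero [simp]: "0 \<in> polys_upto n e"
  by (simp add: polys_upto_def)

lemma polys_upto_add: "p \<in> polys_upto n e \<Longrightarrow> q \<in> polys_upto n e \<Longrightarrow> p + q \<in> polys_upto n e"
  unfolding polys_upto_def using keys_add [of p q] by blast

lemma polys_upto_uminus: "p \<in> polys_upto n e \<Longrightarrow> - p \<in> polys_upto n e"
  by (simp add: polys_upto_def in_keys_iff subset_iff)

lemma polys_upto_mult:
  assumes "p \<in> polys_upto n e" "q \<in> polys_upto n e'"
  shows "p * q \<in> polys_upto n (e + e')"
  using assms keys_mult [of p q] unfolding polys_upto_def by (blast intro: monomials_upto_add)

lemma polys_upto_single: "m \<in> monomials_upto n e \<Longrightarrow> single m c \<in> polys_upto n e"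
  by (simp add: polys_upto_def)

lemma polys_upto_one [simp]: "1 \<in> polys_upto n e"
  by (simp add: polys_upto_def)

lemma polys_upto_power: "p \<in> polys_upto n e \<Longrightarrow> p ^ t \<in> polys_upto n (t * e)"
  by (induction t) (auto intro: polys_upto_mult)

lemma polys_zero [simp]: "0 \<in> polys n"
  and polys_one [simp]: "1 \<in> polys n"
  by (simp_all add: polys_iff)

lemma polys_add: "p \<in> polys n \<Longrightarrow> q \<in> polys n \<Longrightarrow> p + q \<in> polys n"
  unfolding polys_iff using keys_add [of p q] by blast

lemma polys_mult: "p \<in> polys n \<Longrightarrow> q \<in> polys n \<Longrightarrow> p * q \<in> polys n"
  unfolding polys_iff_polys_upto using polys_upto_mult by blast

lemma polys_uminus: "p \<in> polys n \<Longrightarrow> - p \<in> polys n"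
  unfolding polys_iff_polys_upto using polys_upto_uminus by blast

lemma polys_power: "p \<in> polys n \<Longrightarrow> p ^ t \<in> polys n"
  unfolding polys_iff_polys_upto using polys_upto_power by blast

lemma polys_single: "m \<in> monomials n \<Longrightarrow> single m c \<in> polys n"
  by (simp add: polys_iff)

lemma polys_const [simp]: "single 0 c \<in> polys n"
  by (simp add: polys_single)

lemma polys_sum: "(\<And>x. x \<in> S \<Longrightarrow> g x \<in> polys n) \<Longrightarrow> sum g S \<in> polys n"
  by (induction S rule: infinite_finite_induct) (auto intro: polys_add)

lemma polys_mono: "p \<in> polys m \<Longrightarrow> m \<le> n \<Longrightarrow> p \<in> polys n"
  by (force simp: polys_iff monomials_iff subset_iff)

lemma poly_mapping_sum_single:
  fixes p :: "'a \<Rightarrow>\<^sub>0 'b::comm_monoid_add"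
  shows "p = (\<Sum>m\<in>keys p. single m (lookup p m))"
  by (rule poly_mapping_eqI)
    (auto simp: lookup_sum lookup_single when_def in_keys_iff sum.delta)

lemma poly_mapping_induct [case_names single add]:
  fixes p :: "'a \<Rightarrow>\<^sub>0 'b::comm_monoid_add"
  assumes "\<And>m c. P (single m c)" "\<And>p q. P p \<Longrightarrow> P q \<Longrightarrow> P (p + q)"
  shows "P p"
proof -
  have "P (\<Sum>m\<in>S. single m (lookup p m))" for S
    by (induction S rule: infinite_finite_induct)
       (auto intro: assms(2) assms(1) simp: assms(1) [of _ 0, simplified])
  then show ?thesis
    using poly_mapping_sum_single [of p] by metis
qed

lemma lookup_single_mult:
  fixes p :: "'a::cancel_comm_monoid_add \<Rightarrow>\<^sub>0 'b::semiring_0"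
  shows "lookup (single c x * p) (c + m) = x * lookup p m"
proof (induction p rule: poly_mapping_induct)
  case (single m' y)
  then show ?case by (simp add: mult_single lookup_single when_def)
next
  case (add p q)
  then show ?case by (simp add: distrib_left lookup_add)
qed

lemma keys_single_mult:
  fixes p :: "'a::cancel_comm_monoid_add \<Rightarrow>\<^sub>0 'b::semiring_no_zero_divisors"
  assumes "x \<noteq> 0"
  shows "keys (single c x * p) = (+) c ` keys p"
proof
  show "keys (single c x * p) \<subseteq> (+) c ` keys p"
    using keys_mult [of "single c x" p] assms by auto
  show "(+) c ` keys p \<subseteq> keys (single c x * p)"
    using assms by (auto simp: in_keys_iff lookup_single_mult)
qed

section \<open>Noetherianity\<close>

lemma nat_seq_mono_subseq:
  fixes a :: "nat \<Rightarrow> nat"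
  obtains r :: "nat \<Rightarrow> nat" where "strict_mono r" "mono (\<lambda>k. a (r k))"
proof -
  obtain r where r: "strict_mono r" "monoseq (\<lambda>k. a (r k))"
    using seq_monosub by blast
  show thesis
  proof (cases "mono (\<lambda>k. a (r k))")
    case True
    with r that show ?thesis by blast
  next
    case False
    then have decreasing: "a (r l) \<le> a (r k)" if "k \<le> l" for k l
      using r(2) that unfolding monoseq_def mono_def by blast
    obtain k0 where least: "\<And>k. a (r k0) \<le> a (r k)"
      using ex_has_least_nat [of "\<lambda>_. True" 0 "\<lambda>k. a (r k)"] by auto
    have "a (r (k0 + k)) = a (r k0)" for k
      using decreasing [of k0 "k0 + k"] least [of "k0 + k"] by simp
    then have "mono (\<lambda>k. a (r (k0 + k)))"
      by (simp add: mono_def)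
    moreover have "strict_mono (\<lambda>k. r (k0 + k))"
      using r(1) by (simp add: strict_mono_def)
    ultimately show ?thesis using that by blast
  qed
qed

lemma nat_seq_common_mono_subseq:
  fixes a :: "nat \<Rightarrow> nat \<Rightarrow> nat"
  shows "\<exists>r :: nat \<Rightarrow> nat. strict_mono r \<and> (\<forall>i<n. mono (\<lambda>k. a (r k) i))"
proof (induction n)
  case 0
  show ?case by (rule exI [of _ id]) (simp add: strict_mono_def)
next
  case (Suc n)
  then obtain r :: "nat \<Rightarrow> nat" where r: "strict_mono r" "\<And>i. i < n \<Longrightarrow> mono (\<lambda>k. a (r k) i)"
    by blast
  obtain r' :: "nat \<Rightarrow> nat" where r': "strict_mono r'" "mono (\<lambda>k. a (r (r' k)) n)"
    using nat_seq_mono_subseq [of "\<lambda>k. a (r k) n"] by blast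
  have "mono (\<lambda>k. a (r (r' k)) i)" if "i < Suc n" for i
    using that r(2) [of i] r' strict_mono_mono [OF r'(1)]
    by (cases "i = n") (auto simp: mono_def)
  moreover have "strict_mono (\<lambda>k. r (r' k))"
    using r(1) r'(1) by (simp add: strict_mono_def)
  ultimately show ?case by blast
qed

lemma dickson:
  fixes a :: "nat \<Rightarrow> monomial"
  assumes "\<And>k. a k \<in> monomials n"
  obtains i j c where "i < j" "c \<in> monomials n" "a j = c + a i"
proof -
  obtain r :: "nat \<Rightarrow> nat" where r: "strict_mono r" "\<And>i. i < n \<Longrightarrow> mono (\<lambda>k. lookup (a (r k)) i)"
    using nat_seq_common_mono_subseq [of n "\<lambda>k. lookup (a k)"] by blast
  have le: "lookup (a (r 0)) i \<le> lookup (a (r 1)) i" for i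
    using r(2) [of i] assms by (cases "i < n") (auto simp: mono_def monomials_iff)
  show thesis
  proof
    show "r 0 < r 1"
      using r(1) by (simp add: strict_mono_def)
    show "a (r 1) - a (r 0) \<in> monomials n"
      using assms by (simp add: monomials_iff lookup_minus)
    show "a (r 1) = a (r 1) - a (r 0) + a (r 0)"
      using le by (intro poly_mapping_eqI) (simp add: lookup_add lookup_minus)
  qed
qed

lemma poly_mapping_nonneg:
  fixes c :: "'a::linorder \<Rightarrow>\<^sub>0 'b::{canonically_ordered_monoid_add, linorder}"
  shows "0 \<le> c"
proof (cases "c = 0")
  case False
  then have "keys c \<noteq> {}"
    by simp
  then have "Min (keys c) \<in> keys c" "\<And>k'. k' < Min (keys c) \<Longrightarrow> k' \<notin> keys c"
    by (auto simp: Min_gr_iff)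
  then have "0 < c"
    by (auto simp: less_poly_mapping.rep_eq less_fun_def in_keys_iff zero_less_iff_neq_zero
        intro!: exI [of _ "Min (keys c)"])
  then show ?thesis by simp
qed simp

lemma wf_monomials: "wf {(a, b). a \<in> monomials n \<and> b \<in> monomials n \<and> a < b}"
  unfolding wf_iff_no_infinite_down_chain
proof
  assume "\<exists>a. \<forall>k. (a (Suc k), a k) \<in> {(a, b). a \<in> monomials n \<and> b \<in> monomials n \<and> a < b}"
  then obtain a where a: "\<And>k. a k \<in> monomials n" "\<And>k. a (Suc k) < a k"
    by blast
  obtain i j c where ij: "i < j" "a j = c + a i"
    by (rule dickson [of a n, OF a(1)])
  have "a j \<le> a (Suc i)"
    by (rule lift_Suc_antimono_le [of a]) (use a(2) ij(1) in \<open>auto intro: less_imp_le\<close>)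
  then have "a j < a i"
    using a(2) by (rule le_less_trans)
  moreover have "a i \<le> a j"
    using add_right_mono [OF poly_mapping_nonneg [of c], of "a i"] ij by simp
  ultimately show False by simp
qed

definition leading_monomial :: "('a::linorder \<Rightarrow>\<^sub>0 'b::zero) \<Rightarrow> 'a" where
  "leading_monomial p = Max (keys p)"

lemma leading_monomial_in_keys: "p \<noteq> 0 \<Longrightarrow> leading_monomial p \<in> keys p"
  unfolding leading_monomial_def by (simp add: keys_eq_empty)

lemma leading_monomial_ge: "m \<in> keys p \<Longrightarrow> m \<le> leading_monomial p"
  unfolding leading_monomial_def by simp

lemma leading_monomial_shift:
  fixes p :: "'a::{cancel_comm_monoid_add, linordered_cancel_ab_semigroup_add}
    \<Rightarrow>\<^sub>0 'b::semiring_no_zero_divisors"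
  assumes "p \<noteq> 0" "x \<noteq> 0"
  shows "leading_monomial (single c x * p) = c + leading_monomial p"
proof -
  have "mono ((+) c)"
    by (intro monoI add_left_mono)
  from mono_Max_commute [OF this, of "keys p"] show ?thesis
    using assms unfolding leading_monomial_def keys_single_mult [OF assms(2)] by simp
qed

lemma leading_monomial_diff_less:
  fixes p q :: "'a::linorder \<Rightarrow>\<^sub>0 'b::ab_group_add"
  assumes "leading_monomial p = leading_monomial q" "p \<noteq> q"
    and "lookup p (leading_monomial p) = lookup q (leading_monomial p)"
  shows "leading_monomial (p - q) < leading_monomial p"
proof -
  let ?m = "leading_monomial (p - q)"
  have in_keys: "?m \<in> keys (p - q)"
    using assms(2) by (intro leading_monomial_in_keys) simp
  then have "?m \<in> keys p \<or> ?m \<in> keys q"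
    by (auto simp: in_keys_iff lookup_minus)
  then have "?m \<le> leading_monomial p"
    using leading_monomial_ge assms(1) by metis
  moreover have "?m \<noteq> leading_monomial p"
    using in_keys assms(3) by (auto simp: in_keys_iff lookup_minus)
  ultimately show ?thesis by simp
qed

lemma cancel_leading_monomial:
  fixes p q :: "'a::{cancel_comm_monoid_add, linordered_cancel_ab_semigroup_add} \<Rightarrow>\<^sub>0 'k::field"
  assumes "p \<noteq> 0" "q \<noteq> 0" and same: "leading_monomial p = leading_monomial q"
  obtains x where "p = single 0 x * q \<or> leading_monomial (p - single 0 x * q) < leading_monomial p"
proof (cases "p = single 0 (lookup p (leading_monomial p) / lookup q (leading_monomial p)) * q")
  case False
  define x where "x = lookup p (leading_monomial p) / lookup q (leading_monomial p)"
  have q_coeff: "lookup q (leading_monomial p) \<noteq> 0"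
    using leading_monomial_in_keys [OF \<open>q \<noteq> 0\<close>] same by (simp add: in_keys_iff)
  then have "x \<noteq> 0"
    using leading_monomial_in_keys [OF \<open>p \<noteq> 0\<close>] by (simp add: x_def in_keys_iff)
  have "leading_monomial (p - single 0 x * q) < leading_monomial p"
  proof (rule leading_monomial_diff_less)
    show "leading_monomial p = leading_monomial (single 0 x * q)"
      using leading_monomial_shift [OF \<open>q \<noteq> 0\<close> \<open>x \<noteq> 0\<close>, of 0] same by simp
    show "p \<noteq> single 0 x * q"
      using False by (simp add: x_def)
    show "lookup p (leading_monomial p) = lookup (single 0 x * q) (leading_monomial p)"
      using lookup_single_mult [of 0 x q "leading_monomial p"] q_coeff by (simp add: x_def)
  qed
  then show ?thesis
    using that by blast
qed (use that in blast)

definition polys_ideal :: "nat \<Rightarrow> 'k::field mpoly set \<Rightarrow> bool" where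
  "polys_ideal n I \<longleftrightarrow> I \<subseteq> polys n \<and> 0 \<in> I \<and> (\<forall>p\<in>I. \<forall>q\<in>I. p + q \<in> I)
     \<and> (\<forall>a\<in>polys n. \<forall>p\<in>I. a * p \<in> I)"

lemma polys_idealD:
  assumes "polys_ideal n I"
  shows polys_ideal_subset: "I \<subseteq> polys n"
    and polys_ideal_zero: "0 \<in> I"
    and polys_ideal_add: "p \<in> I \<Longrightarrow> q \<in> I \<Longrightarrow> p + q \<in> I"
    and polys_ideal_mult: "a \<in> polys n \<Longrightarrow> p \<in> I \<Longrightarrow> a * p \<in> I"
  using assms unfolding polys_ideal_def by blast+

lemma polys_ideal_diff: "polys_ideal n I \<Longrightarrow> p \<in> I \<Longrightarrow> q \<in> I \<Longrightarrow> p - q \<in> I"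
  using polys_ideal_add [of n I p "- q"] polys_ideal_mult [of n I "- 1" q] polys_uminus [of 1 n]
  by auto

definition leading_monomials :: "'k::field mpoly set \<Rightarrow> monomial set" where
  "leading_monomials I = leading_monomial ` (I - {0})"

lemma leading_monomials_subset: "polys_ideal n I \<Longrightarrow> leading_monomials I \<subseteq> monomials n"
  using polys_ideal_subset leading_monomial_in_keys
  by (fastforce simp: leading_monomials_def polys_iff)

lemma leading_monomials_add:
  assumes "polys_ideal n I" "c \<in> monomials n" "m \<in> leading_monomials I"
  shows "c + m \<in> leading_monomials I"
proof -
  obtain p where p: "p \<in> I" "p \<noteq> 0" "m = leading_monomial p"
    using assms(3) by (auto simp: leading_monomials_def)
  have "single c 1 * p \<in> I"
    using assms p by (intro polys_ideal_mult polys_single)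
  moreover have "c + m = leading_monomial (single c 1 * p)" "single c 1 * p \<noteq> 0"
    using p leading_monomial_shift [of p 1 c]
    by (auto simp flip: keys_eq_empty simp: keys_single_mult)
  ultimately show ?thesis
    by (auto simp: leading_monomials_def)
qed

lemma ideal_eq_of_leading_monomials:
  fixes I J :: "'k::field mpoly set"
  assumes I: "polys_ideal n I" and J: "polys_ideal n J" and "I \<subseteq> J"
    and lead: "leading_monomials J \<subseteq> leading_monomials I"
  shows "I = J"
proof (rule ccontr)
  let ?smaller = "inv_image {(a, b). a \<in> monomials n \<and> b \<in> monomials n \<and> a < b} leading_monomial"
  assume "I \<noteq> J"
  then obtain p0 where "p0 \<in> J - I"
    using \<open>I \<subseteq> J\<close> by blast
  then obtain p where p: "p \<in> J - I" and minimal: "\<And>p'. (p', p) \<in> ?smaller \<Longrightarrow> p' \<notin> J - I"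
    by (rule wfE_min [OF wf_inv_image [OF wf_monomials [of n], of leading_monomial]]) blast
  have nonzero: "p \<noteq> 0"
    using p polys_ideal_zero [OF I] by blast
  then have "leading_monomial p \<in> leading_monomials I"
    using p lead by (auto simp: leading_monomials_def)
  then obtain q where q: "q \<in> I" "q \<noteq> 0" "leading_monomial p = leading_monomial q"
    unfolding leading_monomials_def by blast
  obtain x where x: "p = single 0 x * q \<or>
      leading_monomial (p - single 0 x * q) < leading_monomial p"
    using cancel_leading_monomial [OF nonzero q(2,3)] by blast
  define r where "r = p - single 0 x * q"
  have xq: "single 0 x * q \<in> I"
    using q by (intro polys_ideal_mult [OF I] polys_single) auto
  then have r: "r \<in> J - I"
    using p \<open>I \<subseteq> J\<close> polys_ideal_diff [OF J] polys_ideal_add [OF I, of r "single 0 x * q"]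
    by (auto simp: r_def)
  have "leading_monomial r < leading_monomial p"
    using x p xq by (auto simp: r_def)
  moreover have "r \<noteq> 0"
    using r polys_ideal_zero [OF I] by blast
  then have "leading_monomial r \<in> monomials n" "leading_monomial p \<in> monomials n"
    using r p nonzero leading_monomials_subset [OF J] by (auto simp: leading_monomials_def)
  ultimately show False
    using minimal [of r] r by simp
qed

theorem wf_polys_ideals:
  "wf {(J, I :: 'k::field mpoly set). polys_ideal n I \<and> polys_ideal n J \<and> I \<subset> J}"
  unfolding wf_iff_no_infinite_down_chain
proof
  assume "\<exists>I. \<forall>k. (I (Suc k), I k) \<in>
    {(J, I :: 'k mpoly set). polys_ideal n I \<and> polys_ideal n J \<and> I \<subset> J}"
  then obtain I :: "nat \<Rightarrow> 'k mpoly set"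
    where I: "\<And>k. polys_ideal n (I k)" and strict: "\<And>k. I k \<subset> I (Suc k)"
    by blast
  have "\<exists>m. m \<in> leading_monomials (I (Suc k)) - leading_monomials (I k)" for k
    using ideal_eq_of_leading_monomials [OF I I, of k "Suc k"] strict [of k] by blast
  then obtain m where m: "\<And>k. m k \<in> leading_monomials (I (Suc k))"
      "\<And>k. m k \<notin> leading_monomials (I k)"
    by (metis DiffD1 DiffD2)
  obtain i j c where ij: "i < j" "c \<in> monomials n" "m j = c + m i"
    by (rule dickson [of m n, OF subsetD [OF leading_monomials_subset [OF I] m(1)]])
  have "I (Suc i) \<subseteq> I j"
    by (rule lift_Suc_mono_le [of I]) (use strict ij(1) in auto)
  then have "m i \<in> leading_monomials (I j)"
    using m(1) [of i] by (auto simp: leading_monomials_def)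
  then show False
    using leading_monomials_add [OF I ij(2)] ij(3) m(2) by metis
qed

section \<open>Divided derivatives of polynomials\<close>

lemma minus_single_eq_iff:
  fixes a m :: "'a \<Rightarrow>\<^sub>0 nat"
  assumes "t \<le> lookup a i"
  shows "a - single i t = m \<longleftrightarrow> a = m + single i t"
proof
  assume m: "a - single i t = m"
  show "a = m + single i t"
    unfolding m [symmetric] using assms
    by (intro poly_mapping_eqI) (auto simp: lookup_add lookup_minus lookup_single when_def)
qed simp

lemma lookup_dpart:
  "lookup (dpart i t p) m = of_nat ((lookup m i + t) choose t) * lookup p (m + single i t)"
proof -
  have "lookup (dpart i t p) m =
      (\<Sum>a\<in>keys p. of_nat (lookup a i choose t) * lookup p a when a = m + single i t)"
    unfolding dpart_def lookup_sum lookup_single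
  proof (intro sum.cong refl)
    fix a assume "a \<in> keys p"
    show "(of_nat (lookup a i choose t) * lookup p a when a - single i t = m) =
          (of_nat (lookup a i choose t) * lookup p a when a = m + single i t)"
      using minus_single_eq_iff [of t a i m]
      by (cases "t \<le> lookup a i") (auto simp: when_def binomial_eq_0)
  qed
  then show ?thesis
    by (auto simp: when_def sum.delta in_keys_iff lookup_add)
qed

lemma keys_dpart: "m \<in> keys (dpart i t p) \<Longrightarrow> m + single i t \<in> keys p"
  by (auto simp: in_keys_iff lookup_dpart)

lemma dpart_add: "dpart i t (p + q) = dpart i t p + dpart i t q"
  by (rule poly_mapping_eqI) (simp add: lookup_dpart lookup_add algebra_simps)

lemma dpart_order_zero [simp]: "dpart i 0 p = p"
  by (rule poly_mapping_eqI) (simp add: lookup_dpart)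

lemma dpart_single:
  "dpart i t (single m c) = single (m - single i t) (of_nat (lookup m i choose t) * c)"
  by (cases "c = 0") (simp_all add: dpart_def)

lemma dpart_single_mult_dpart_single:
  fixes c c' :: "'k::field"
  assumes "a \<le> t"
  shows "dpart i a (single m c) * dpart i (t - a) (single m' c') =
    single (m + m' - single i t)
      (of_nat ((lookup m i choose a) * (lookup m' i choose (t - a))) * (c * c'))"
proof (cases "a \<le> lookup m i \<and> t - a \<le> lookup m' i")
  case True
  have "(m - single i a) + (m' - single i (t - a)) = m + m' - single i t"
    using True assms
    by (intro poly_mapping_eqI) (auto simp: lookup_minus lookup_add lookup_single when_def)
  then show ?thesis
    by (simp add: dpart_single mult_single algebra_simps)
next
  case False
  then have "lookup m i choose a = 0 \<or> lookup m' i choose (t - a) = 0"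
    by (auto simp: binomial_eq_0)
  then show ?thesis
    unfolding dpart_single mult_single
    by (elim disjE) (simp_all only: of_nat_0 mult_zero_left mult_zero_right single_zero)
qed

lemma dpart_mult_single:
  "dpart i t (single m c * single m' c') =
    (\<Sum>a\<le>t. dpart i a (single m c) * dpart i (t - a) (single m' c'))"
proof -
  have "(\<Sum>a\<le>t. dpart i a (single m c) * dpart i (t - a) (single m' c')) =
      (\<Sum>a\<le>t. single (m + m' - single i t)
          (of_nat ((lookup m i choose a) * (lookup m' i choose (t - a))) * (c * c')))"
    by (intro sum.cong refl dpart_single_mult_dpart_single) simp
  also have "\<dots> = single (m + m' - single i t)
        (of_nat (\<Sum>a\<le>t. (lookup m i choose a) * (lookup m' i choose (t - a))) * (c * c'))"
    by (rule poly_mapping_eqI)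
      (simp add: lookup_sum lookup_single when_def sum_distrib_right)
  finally show ?thesis
    by (simp add: vandermonde mult_single dpart_single lookup_add)
qed

lemma dpart_mult:
  "dpart i t (p * q) = (\<Sum>a\<le>t. dpart i a p * dpart i (t - a) q)"
proof (induction p rule: poly_mapping_induct)
  case (single m c)
  show ?case
  proof (induction q rule: poly_mapping_induct)
    case (single m' c')
    show ?case by (rule dpart_mult_single)
  next
    case (add q r)
    then show ?case
      by (simp add: dpart_add sum.distrib distrib_left)
  qed
next
  case (add p r)
  then show ?case
    by (simp add: dpart_add sum.distrib distrib_right)
qed

lemma dpart_dpart:
  "dpart i a (dpart i r g) = of_nat ((a + r) choose r) * dpart i (a + r) g"
proof (rule poly_mapping_eqI)
  fix m
  have "((lookup m i + a) choose a) * ((lookup m i + a + r) choose r) =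
        ((a + r) choose r) * ((lookup m i + (a + r)) choose (a + r))"
    using choose_mult [of r "a + r" "lookup m i + (a + r)"]
    by (simp add: algebra_simps)
  then have "of_nat ((lookup m i + a) choose a) * of_nat ((lookup m i + a + r) choose r) =
        (of_nat ((a + r) choose r) * of_nat ((lookup m i + (a + r)) choose (a + r)) :: 'a)"
    by (metis of_nat_mult)
  moreover have "lookup (of_nat k * p) m = of_nat k * lookup p m" for k :: nat and p :: "'a mpoly"
    using lookup_single_mult [of 0 "of_nat k" p m] by simp
  ultimately show "lookup (dpart i a (dpart i r g)) m =
      lookup (of_nat ((a + r) choose r) * dpart i (a + r) g) m"
    by (simp add: lookup_dpart lookup_add single_add add.assoc flip: mult.assoc)
qed

lemma dpart_eq_0:
  assumes "g \<in> polys i" "t > 0"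
  shows "dpart i t g = 0"
proof (rule poly_mapping_eqI)
  fix m
  have "m + single i t \<notin> monomials i"
    using assms by (auto simp: monomials_iff lookup_add)
  then have "m + single i t \<notin> keys g"
    using assms by (auto simp: polys_iff)
  then show "lookup (dpart i t g) m = lookup 0 m"
    by (simp add: lookup_dpart in_keys_iff)
qed

lemma dpart_one: "dpart i t 1 = (if t = 0 then 1 else 0)"
  by (simp add: dpart_eq_0)

lemma polys_upto_dpart: "p \<in> polys_upto n e \<Longrightarrow> dpart i t p \<in> polys_upto n e"
  unfolding polys_upto_def
proof safe
  fix m assume "keys p \<subseteq> monomials_upto n e" "m \<in> keys (dpart i t p)"
  then have "m + single i t \<in> monomials_upto n e"
    using keys_dpart by blast
  then show "m \<in> monomials_upto n e"
    by (auto simp: monomials_upto_def monomials_iff lookup_add monomial_degree_add)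
qed

lemma polys_dpart: "p \<in> polys n \<Longrightarrow> dpart i t p \<in> polys n"
  unfolding polys_iff_polys_upto using polys_upto_dpart by blast

lemma leading_coefficient_by_dpart:
  fixes h :: "'k::field mpoly"
  assumes "h \<in> polys (Suc m)" "h \<noteq> 0"
  obtains e b where "b \<in> keys h" "lookup b m = e" "dpart m e h \<noteq> 0" "dpart m e h \<in> polys m"
proof -
  define e where "e = (MAX b\<in>keys h. lookup b m)"
  have max: "lookup b m \<le> e" if "b \<in> keys h" for b
    unfolding e_def using that by (intro Max_ge) auto
  obtain b where b: "b \<in> keys h" "lookup b m = e"
    unfolding e_def using \<open>h \<noteq> 0\<close> by (metis keys_eq_empty finite_keys obtains_MAX)
  have "b - single m e + single m e = b"
    using b minus_single_eq_iff [of e b m] by (metis order_refl)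
  then have "lookup (dpart m e h) (b - single m e) = lookup h b"
    using b by (simp add: lookup_dpart lookup_minus)
  then have "dpart m e h \<noteq> 0"
    using b by (metis in_keys_iff lookup_zero)
  moreover have "b' \<in> monomials m" if "b' \<in> keys (dpart m e h)" for b'
  proof -
    have "b' + single m e \<in> keys h"
      using that by (rule keys_dpart)
    then have "b' + single m e \<in> monomials (Suc m)" "lookup b' m = 0"
      using assms(1) max [of "b' + single m e"] by (auto simp: polys_iff lookup_add)
    then show ?thesis
      unfolding monomials_iff lookup_add by (metis add_is_0 le_eq_less_or_eq Suc_le_eq)
  qed
  then have "dpart m e h \<in> polys m"
    by (auto simp: polys_iff)
  ultimately show thesis
    using that b by blast
qed

definition signed_dpart :: "nat \<Rightarrow> nat \<Rightarrow> 'k::field mpoly \<Rightarrow> 'k mpoly" where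
  "signed_dpart i r g = (- 1) ^ r * dpart i r g"

lemma signed_dpart_eq: "signed_dpart i r g = (if even r then dpart i r g else - dpart i r g)"
  by (simp add: signed_dpart_def)

lemma polys_signed_dpart: "g \<in> polys n \<Longrightarrow> signed_dpart i r g \<in> polys n"
  by (simp add: signed_dpart_eq polys_dpart polys_uminus)

lemma dpart_signed_dpart:
  "dpart i a (signed_dpart i r g) =
    (- 1) ^ r * of_nat ((r + a) choose r) * dpart i (r + a) g"
proof -
  have "dpart i a (- h) = - dpart i a h" for h :: "'a mpoly"
    by (rule poly_mapping_eqI) (simp add: lookup_dpart)
  then show ?thesis
    by (simp add: signed_dpart_eq dpart_dpart add.commute)
qed

section \<open>Families independent modulo a subspace\<close>

definition independent_modulo ::
    "('c::zero \<Rightarrow> 'b \<Rightarrow> 'b) \<Rightarrow> 'b::comm_monoid_add set \<Rightarrow> ('i \<Rightarrow> 'b) \<Rightarrow> 'i set \<Rightarrow> bool" where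
  "independent_modulo scale A u I \<longleftrightarrow>
     (\<forall>c. (\<Sum>i\<in>I. scale (c i) (u i)) \<in> A \<longrightarrow> (\<forall>i\<in>I. c i = 0))"

lemma independent_moduloI:
  "(\<And>c i. (\<Sum>i\<in>I. scale (c i) (u i)) \<in> A \<Longrightarrow> i \<in> I \<Longrightarrow> c i = 0) \<Longrightarrow>
    independent_modulo scale A u I"
  unfolding independent_modulo_def by blast

lemma independent_moduloD:
  "independent_modulo scale A u I \<Longrightarrow> (\<Sum>i\<in>I. scale (c i) (u i)) \<in> A \<Longrightarrow> i \<in> I \<Longrightarrow> c i = 0"
  unfolding independent_modulo_def by blast

lemma (in vector_space) independent_modulo_card_le:
  assumes "finite I" "finite T" "u ` I \<subseteq> span T" "0 \<in> A" and ind: "independent_modulo scale A u I"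
  shows "card I \<le> card T"
proof -
  have inj: "inj_on u I"
  proof (rule inj_onI, rule ccontr)
    fix x y assume xy: "x \<in> I" "y \<in> I" "u x = u y" "x \<noteq> y"
    let ?c = "\<lambda>z. if z = x then 1 else if z = y then - 1 else 0"
    have "(\<Sum>z\<in>I. ?c z *s u z) = (\<Sum>z\<in>{x, y}. ?c z *s u z)"
      using xy \<open>finite I\<close> by (intro sum.mono_neutral_right) auto
    also have "\<dots> = 0"
      using xy by simp
    finally show False
      using independent_moduloD [OF ind, where c = ?c and i = x] xy \<open>0 \<in> A\<close> by simp
  qed
  have "independent (u ` I)"
  proof (rule independent_if_scalars_zero)
    fix c v assume "(\<Sum>v\<in>u ` I. c v *s v) = 0" "v \<in> u ` I"
    then show "c v = 0"
      using independent_moduloD [OF ind, of "\<lambda>x. c (u x)"] \<open>0 \<in> A\<close>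
      by (auto simp: sum.reindex [OF inj])
  qed (use assms in auto)
  then have "card (u ` I) \<le> card T"
    using independent_span_bound assms by blast
  then show ?thesis
    by (simp add: card_image inj)
qed

lemma (in vector_space) independent_modulo_Un:
  assumes "finite I" "finite J" "I \<inter> J = {}" and B: "subspace B" "A \<subseteq> B"
    and u: "\<And>i. i \<in> I \<Longrightarrow> u i \<in> B"
    and I: "independent_modulo scale A u I" and J: "independent_modulo scale B u J"
  shows "independent_modulo scale A u (I \<union> J)"
proof (rule independent_moduloI)
  fix c x
  assume "(\<Sum>i\<in>I \<union> J. c i *s u i) \<in> A" and "x \<in> I \<union> J"
  then have sum: "(\<Sum>i\<in>I. c i *s u i) + (\<Sum>i\<in>J. c i *s u i) \<in> A"
    using assms(1-3) by (simp add: sum.union_disjoint)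
  moreover have "(\<Sum>i\<in>I. c i *s u i) \<in> B"
    using u by (intro subspace_sum subspace_scale B(1))
  ultimately have "(\<Sum>i\<in>J. c i *s u i) \<in> B"
    using B subspace_diff [OF B(1)] by (metis add_diff_cancel_left' subsetD)
  then have zero: "c i = 0" if "i \<in> J" for i
    using independent_moduloD [OF J] that by blast
  then have "(\<Sum>i\<in>I. c i *s u i) \<in> A"
    using sum by simp
  then show "c x = 0"
    using independent_moduloD [OF I] zero \<open>x \<in> I \<union> J\<close> by blast
qed

lemma (in vector_space) independent_modulo_chain:
  assumes "finite I" "\<And>m. m \<le> l \<Longrightarrow> subspace (N m)" "\<And>m. m < l \<Longrightarrow> N m \<subseteq> N (Suc m)"
    and "\<And>m i. m < l \<Longrightarrow> i \<in> I \<Longrightarrow> u m i \<in> N (Suc m)"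
    and "\<And>m. m < l \<Longrightarrow> independent_modulo scale (N m) (u m) I"
  shows "independent_modulo scale (N 0) (\<lambda>(m, i). u m i) ({..<l} \<times> I)"
  using assms
proof (induction l)
  case 0
  show ?case by (simp add: independent_modulo_def)
next
  case (Suc l)
  have mono: "N m \<subseteq> N l" if "m \<le> l" for m
    by (rule lift_Suc_mono_le_ivl [of "{..<l}" N]) (use Suc.prems(3) that in auto)
  have "independent_modulo scale (N 0) (\<lambda>(m, i). u m i) ({..<l} \<times> I \<union> {l} \<times> I)"
  proof (rule independent_modulo_Un [of _ _ "N l"])
    show "(case x of (m, i) \<Rightarrow> u m i) \<in> N l" if "x \<in> {..<l} \<times> I" for x
      using that Suc.prems(4) [of "fst x" "snd x"] mono [of "Suc (fst x)"] by auto
    show "independent_modulo scale (N 0) (\<lambda>(m, i). u m i) ({..<l} \<times> I)"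
      using Suc.prems by (intro Suc.IH) auto
    show "independent_modulo scale (N l) (\<lambda>(m, i). u m i) ({l} \<times> I)"
      using Suc.prems(5) [of l] unfolding independent_modulo_def
      by (auto simp: sum.cartesian_product')
  qed (use Suc.prems mono in auto)
  moreover have "{..<Suc l} \<times> I = {..<l} \<times> I \<union> {l} \<times> I"
    by auto
  ultimately show ?case
    by (simp only:)
qed

section \<open>D-modules\<close>

text \<open>The scalars are the polynomials in all the variables \<open>x\<^sub>0, x\<^sub>1, \<dots>\<close>; their number \<open>n\<close> only
  enters through the submodules.\<close>

locale dmodule = module scale
  for scale :: "'k::field mpoly \<Rightarrow> 'm::ab_group_add \<Rightarrow> 'm" (infixr \<open>*s\<close> 75) +
  fixes deriv :: "nat \<Rightarrow> nat \<Rightarrow> 'm \<Rightarrow> 'm"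
  assumes deriv_add: "deriv i t (u + v) = deriv i t u + deriv i t v"
    and deriv_order_zero [simp]: "deriv i 0 v = v"
    and deriv_scale: "deriv i t (g *s v) = (\<Sum>a\<le>t. dpart i a g *s deriv i (t - a) v)"
begin

sublocale deriv: additive "deriv i t" for i t
  by standard (rule deriv_add)

abbreviation const_scale :: "'k \<Rightarrow> 'm \<Rightarrow> 'm" where
  "const_scale c v \<equiv> single 0 c *s v"

sublocale vs: vector_space const_scale
  by standard (simp_all add: single_add mult_single algebra_simps)

lemma deriv_scale_const:
  assumes "g \<in> polys i"
  shows "deriv i t (g *s v) = g *s deriv i t v"
proof -
  have "deriv i t (g *s v) = (\<Sum>a\<le>t. if a = 0 then g *s deriv i t v else 0)"
    unfolding deriv_scale by (rule sum.cong) (auto simp: dpart_eq_0 [OF assms])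
  then show ?thesis
    by simp
qed

lemma scale_deriv:
  "g *s deriv i t v = (\<Sum>r\<le>t. deriv i (t - r) (signed_dpart i r g *s v))"
proof -
  let ?f = "\<lambda>r a. ((- 1) ^ r * of_nat ((r + a) choose r) * dpart i (r + a) g)
      *s deriv i (t - (r + a)) v"
  have "(\<Sum>r\<le>t. deriv i (t - r) (signed_dpart i r g *s v)) = (\<Sum>r\<le>t. \<Sum>a\<le>t - r. ?f r a)"
    by (simp add: deriv_scale dpart_signed_dpart)
  also have "\<dots> = sum (\<lambda>(r, a). ?f r a) {(r, a). r + a \<le> t}"
    by (subst sum.Sigma) (auto intro!: sum.cong)
  also have "\<dots> = (\<Sum>k\<le>t. \<Sum>r\<le>k. ?f r (k - r))"
    by (rule sum.triangle_reindex_eq)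
  also have "\<dots> = (\<Sum>k\<le>t. ((\<Sum>r\<le>k. (- 1) ^ r * of_nat (k choose r)) * dpart i k g)
      *s deriv i (t - k) v)"
    by (simp add: sum_distrib_right scale_sum_left)
  also have "\<dots> = (\<Sum>k\<le>t. if k = 0 then g *s deriv i t v else 0)"
    by (intro sum.cong refl) (auto simp: choose_alternating_sum)
  finally show ?thesis
    by simp
qed

definition derivs :: "nat list \<Rightarrow> (nat \<Rightarrow> nat) \<Rightarrow> 'm \<Rightarrow> 'm" where
  "derivs js e = fold (\<lambda>j. deriv j (e j)) js"

lemma derivs_Nil [simp]: "derivs [] e v = v"
  and derivs_Cons [simp]: "derivs (j # js) e v = derivs js e (deriv j (e j) v)"
  by (simp_all add: derivs_def)

sublocale derivs: additive "derivs js e" for js e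
proof
  show "derivs js e (u + v) = derivs js e u + derivs js e v" for u v
    by (induction js arbitrary: u v) (simp_all add: deriv_add)
qed

lemma derivs_scale_const:
  "(\<And>j. j \<in> set js \<Longrightarrow> g \<in> polys j) \<Longrightarrow> derivs js e (g *s v) = g *s derivs js e v"
  by (induction js arbitrary: v) (simp_all add: deriv_scale_const)

definition dsubmodule :: "nat \<Rightarrow> 'm set \<Rightarrow> bool" where
  "dsubmodule n M \<longleftrightarrow> 0 \<in> M \<and> (\<forall>u\<in>M. \<forall>v\<in>M. u + v \<in> M) \<and>
     (\<forall>a\<in>polys n. \<forall>v\<in>M. a *s v \<in> M) \<and> (\<forall>i<n. \<forall>t. \<forall>v\<in>M. deriv i t v \<in> M)"

lemma dsubmoduleI:
  assumes "0 \<in> M" "\<And>u v. u \<in> M \<Longrightarrow> v \<in> M \<Longrightarrow> u + v \<in> M"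
    and "\<And>a v. a \<in> polys n \<Longrightarrow> v \<in> M \<Longrightarrow> a *s v \<in> M"
    and "\<And>i t v. i < n \<Longrightarrow> v \<in> M \<Longrightarrow> deriv i t v \<in> M"
  shows "dsubmodule n M"
  using assms unfolding dsubmodule_def by blast

lemma dsubmoduleD:
  assumes "dsubmodule n M"
  shows dsubmodule_zero: "0 \<in> M"
    and dsubmodule_add: "u \<in> M \<Longrightarrow> v \<in> M \<Longrightarrow> u + v \<in> M"
    and dsubmodule_scale: "a \<in> polys n \<Longrightarrow> v \<in> M \<Longrightarrow> a *s v \<in> M"
    and dsubmodule_deriv: "i < n \<Longrightarrow> v \<in> M \<Longrightarrow> deriv i t v \<in> M"
  using assms unfolding dsubmodule_def by blast+

lemma subspace_dsubmodule: "dsubmodule n M \<Longrightarrow> vs.subspace M"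
  by (intro vs.subspaceI) (auto intro: dsubmodule_zero dsubmodule_add dsubmodule_scale)

lemmas dsubmodule_diff = vs.subspace_diff [OF subspace_dsubmodule]
  and dsubmodule_sum = vs.subspace_sum [OF subspace_dsubmodule]

lemma dsubmodule_derivs:
  "dsubmodule n M \<Longrightarrow> set js \<subseteq> {..<n} \<Longrightarrow> v \<in> M \<Longrightarrow> derivs js e v \<in> M"
  by (induction js arbitrary: v) (auto intro: dsubmodule_deriv)

lemma dsubmodule_congruent:
  assumes "dsubmodule n M" "u - v \<in> M"
  shows "u \<in> M \<longleftrightarrow> v \<in> M"
  using dsubmodule_add [of n M "u - v" v] dsubmodule_diff [of n M u "u - v"] assms by auto

lemma dsubmodule_sum_congruent:
  assumes "dsubmodule n M" "\<And>x. x \<in> S \<Longrightarrow> g x - h x \<in> M"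
  shows "sum g S \<in> M \<longleftrightarrow> sum h S \<in> M"
  using dsubmodule_sum [OF assms(1), of S "\<lambda>x. g x - h x"] assms
  by (intro dsubmodule_congruent) (simp_all add: sum_subtractf)

definition annihilator :: "nat \<Rightarrow> 'm set \<Rightarrow> 'm \<Rightarrow> 'k mpoly set" where
  "annihilator n A w = {g \<in> polys n. g *s w \<in> A}"

lemma annihilator_iff: "g \<in> annihilator n A w \<longleftrightarrow> g \<in> polys n \<and> g *s w \<in> A"
  by (simp add: annihilator_def)

lemma polys_ideal_annihilator: "dsubmodule n A \<Longrightarrow> polys_ideal n (annihilator n A w)"
  unfolding polys_ideal_def
  by (auto simp: annihilator_iff scale_left_distrib polys_add polys_mult dsubmodule_zero
      dsubmodule_add simp flip: scale_scale intro: dsubmodule_scale)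

lemma annihilator_scale_superset:
  assumes "dsubmodule n A" "g \<in> polys n"
  shows "annihilator n A w \<subseteq> annihilator n A (g *s w)"
proof
  fix h assume "h \<in> annihilator n A w"
  then have "h \<in> polys n" "g *s (h *s w) \<in> A"
    using dsubmodule_scale [OF assms] unfolding annihilator_iff by blast+
  then show "h \<in> annihilator n A (g *s w)"
    by (simp add: annihilator_iff mult.commute)
qed

end

locale prime_annihilator = dmodule scale deriv
  for scale :: "'k::field mpoly \<Rightarrow> 'm::ab_group_add \<Rightarrow> 'm" (infixr \<open>*s\<close> 75) and deriv +
  fixes n :: nat and A :: "'m set" and w :: 'm
  assumes A: "dsubmodule n A" and w_notin_A: "w \<notin> A"
    and prime: "g \<in> polys n \<Longrightarrow> h \<in> polys n \<Longrightarrow> (g * h) *s w \<in> A \<Longrightarrow> g *s w \<notin> A \<Longrightarrow> h *s w \<in> A"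
begin

abbreviation P :: "'k mpoly set" where
  "P \<equiv> annihilator n A w"

lemma ideal_P: "polys_ideal n P"
  using A by (rule polys_ideal_annihilator)

lemma P_polys: "g \<in> P \<Longrightarrow> g \<in> polys n"
  by (simp add: annihilator_iff)

lemma P_prime_power:
  assumes "g \<in> polys n" "h \<in> polys n" "g ^ t * h \<in> P" "t = 0 \<or> g \<notin> P"
  shows "h \<in> P"
  using assms
proof (induction t)
  case (Suc t)
  then have "g ^ t * h \<in> P"
    using prime [of g "g ^ t * h"]
    by (auto simp: annihilator_iff mult.assoc intro: polys_mult polys_power)
  with Suc show ?case by auto
qed simp

lemma signed_dpart_in_P_iff: "signed_dpart i r g \<in> P \<longleftrightarrow> dpart i r g \<in> P"
  using polys_ideal_mult [OF ideal_P polys_uminus [OF polys_one], of "dpart i r g"]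
    polys_ideal_mult [OF ideal_P polys_uminus [OF polys_one], of "- dpart i r g"]
  by (auto simp: signed_dpart_eq)

lemma nonzero_const_notin_P:
  assumes "h \<in> polys 0" "h \<noteq> 0"
  shows "h \<notin> P"
proof
  assume "h \<in> P"
  define c where "c = lookup h 0"
  have "keys h \<subseteq> {0}"
    using assms by (auto simp: polys_iff monomials_def)
  then have "keys h = {0}"
    using \<open>h \<noteq> 0\<close> by (metis keys_eq_empty subset_singletonD)
  then have h: "h = single 0 c" and "c \<noteq> 0"
    using poly_mapping_sum_single [of h] by (auto simp: c_def in_keys_iff)
  then have "single 0 (inverse c) * h = 1"
    by (simp add: mult_single)
  moreover have "single 0 (inverse c) * h \<in> P"
    using \<open>h \<in> P\<close> by (intro polys_ideal_mult [OF ideal_P] polys_single) auto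
  ultimately show False
    using w_notin_A by (simp add: annihilator_iff)
qed

definition escapes :: "nat \<Rightarrow> nat \<Rightarrow> bool" where
  "escapes i r \<longleftrightarrow> (\<exists>g \<in> P \<inter> polys (Suc i). dpart i r g \<notin> P)"

text \<open>If no derivative escapes, every exponent of \<open>x\<^sub>i\<close> counts as reduced; the value \<open>0\<close> achieves
  this, because \<open>b div 0 = 0\<close> and \<open>b mod 0 = b\<close>.\<close>
definition escape_order :: "nat \<Rightarrow> nat" where
  "escape_order i = (if \<exists>r. escapes i r then LEAST r. escapes i r else 0)"

lemma escapes_escape_order: "escape_order i \<noteq> 0 \<Longrightarrow> escapes i (escape_order i)"
  unfolding escape_order_def by (auto intro: LeastI split: if_splits)

lemma not_escapes:
  assumes "escape_order i = 0 \<or> r < escape_order i"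
  shows "\<not> escapes i r"
proof
  assume "escapes i r"
  then have least: "escape_order i = (LEAST r. escapes i r)"
    unfolding escape_order_def by auto
  then have "escapes i (escape_order i)" "escape_order i \<le> r"
    using \<open>escapes i r\<close> by (simp_all add: LeastI Least_le)
  moreover have "\<not> escapes i 0"
    by (simp add: escapes_def)
  ultimately show False
    using assms by auto
qed

lemma dpart_in_P:
  "g \<in> P \<Longrightarrow> g \<in> polys (Suc i) \<Longrightarrow> escape_order i = 0 \<or> r < escape_order i \<Longrightarrow> dpart i r g \<in> P"
  using not_escapes unfolding escapes_def by blast

lemma escape_witness:
  obtains g where "g \<in> P" "g \<in> polys (Suc i)" "escape_order i = 0 \<or> dpart i (escape_order i) g \<notin> P"
proof (cases "escape_order i = 0")
  case True
  then show thesis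
    using that [of 0] polys_ideal_zero [OF ideal_P] by simp
next
  case False
  then show thesis
    using that escapes_escape_order unfolding escapes_def by blast
qed

lemma reduced_in_P_eq_0:
  assumes "h \<in> polys m" "h \<in> P"
    and "\<And>b i. b \<in> keys h \<Longrightarrow> i < m \<Longrightarrow> escape_order i = 0 \<or> lookup b i < escape_order i"
  shows "h = 0"
  using assms
proof (induction m arbitrary: h)
  case 0
  then show ?case
    using nonzero_const_notin_P by blast
next
  case (Suc m)
  show ?case
  proof (rule ccontr)
    assume "h \<noteq> 0"
    with Suc.prems(1) obtain e b0 where e: "b0 \<in> keys h" "lookup b0 m = e"
      "dpart m e h \<noteq> 0" "dpart m e h \<in> polys m"
      by (rule leading_coefficient_by_dpart)
    have "dpart m e h = 0"
    proof (rule Suc.IH)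
      show "dpart m e h \<in> P"
        using Suc.prems(3) [OF e(1), of m] e(2) by (intro dpart_in_P Suc.prems(1,2)) auto
    next
      fix b i assume "b \<in> keys (dpart m e h)" "i < m"
      then show "escape_order i = 0 \<or> lookup b i < escape_order i"
        using Suc.prems(3) [OF keys_dpart, of b m e i] by (auto simp: lookup_add)
    qed (rule e(4))
    with e(3) show False by contradiction
  qed
qed

lemma scale_power_deriv:
  "g ^ Suc Q *s deriv i t (k *s w) =
    (\<Sum>r\<le>t. g ^ Q *s deriv i (t - r) ((signed_dpart i r g * k) *s w))"
proof -
  have "g ^ Suc Q *s deriv i t (k *s w) = g ^ Q *s (g *s deriv i t (k *s w))"
    by (simp add: mult.commute)
  then show ?thesis
    unfolding scale_deriv [of g] by (simp add: scale_sum_right)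
qed

lemma scale_deriv_signed_dpart_in_A:
  assumes "i < n" "g \<in> polys n" "k \<in> polys n" "dpart i r g \<in> P"
  shows "g ^ Q *s deriv i t ((signed_dpart i r g * k) *s w) \<in> A"
proof -
  have "k * signed_dpart i r g \<in> P"
    using assms by (intro polys_ideal_mult [OF ideal_P]) (simp_all add: signed_dpart_in_P_iff)
  then have "(signed_dpart i r g * k) *s w \<in> A"
    by (simp add: annihilator_iff mult.commute)
  from dsubmodule_deriv [OF A assms(1) this] show ?thesis
    by (rule dsubmodule_scale [OF A polys_power [OF assms(2)]])
qed

lemma power_kills_low_order:
  assumes "i < n" "g \<in> P" "\<And>r. r < s \<Longrightarrow> dpart i r g \<in> P" "k \<in> polys n" "t < s * Q"
  shows "g ^ Q *s deriv i t (k *s w) \<in> A"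
  using assms(4,5)
proof (induction Q arbitrary: t k)
  case (Suc Q)
  have g: "g \<in> polys n"
    using assms(2) by (rule P_polys)
  show ?case
    unfolding scale_power_deriv
  proof (rule dsubmodule_sum [OF A])
    fix r assume r: "r \<in> {..t}"
    show "g ^ Q *s deriv i (t - r) ((signed_dpart i r g * k) *s w) \<in> A"
    proof (cases "r < s")
      case True
      then show ?thesis
        using assms(1,3) g Suc.prems by (intro scale_deriv_signed_dpart_in_A)
    next
      case False
      then have "t - r < s * Q"
        using r Suc.prems(2) by auto
      then show ?thesis
        using Suc.prems g by (intro Suc.IH polys_mult polys_signed_dpart)
    qed
  qed
qed simp

lemma power_strips_derivative:
  assumes "i < n" "g \<in> P" "\<And>r. r < s \<Longrightarrow> dpart i r g \<in> P" "k \<in> polys n"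
  shows "g ^ Q *s deriv i (s * Q) (k *s w) - (signed_dpart i s g ^ Q * k) *s w \<in> A"
  using assms(4)
proof (induction Q arbitrary: k)
  case 0
  then show ?case
    using dsubmodule_zero [OF A] by simp
next
  case (Suc Q)
  let ?t = "s * Suc Q"
  let ?term = "\<lambda>r. g ^ Q *s deriv i (?t - r) ((signed_dpart i r g * k) *s w)"
  have g: "g \<in> polys n"
    using assms(2) by (rule P_polys)
  have "?term r \<in> A" if r: "r \<le> ?t" "r \<noteq> s" for r
  proof (cases "r < s")
    case True
    then show ?thesis
      using assms(1,3) g Suc.prems by (intro scale_deriv_signed_dpart_in_A)
  next
    case False
    then have "?t - r < s * Q"
      using r by simp
    then show ?thesis
      using g Suc.prems
      by (intro power_kills_low_order [OF assms(1-3)] polys_mult polys_signed_dpart)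
  qed
  then have rest: "(\<Sum>r\<in>{..?t} - {s}. ?term r) \<in> A"
    by (intro dsubmodule_sum [OF A]) auto
  have top: "?term s - (signed_dpart i s g ^ Suc Q * k) *s w \<in> A"
    using Suc.IH [of "signed_dpart i s g * k"] g Suc.prems
    by (simp add: polys_mult polys_signed_dpart mult_ac)
  have "g ^ Suc Q *s deriv i ?t (k *s w) = ?term s + (\<Sum>r\<in>{..?t} - {s}. ?term r)"
    unfolding scale_power_deriv by (intro sum.remove) auto
  then have "g ^ Suc Q *s deriv i ?t (k *s w) - (signed_dpart i s g ^ Suc Q * k) *s w =
      (?term s - (signed_dpart i s g ^ Suc Q * k) *s w) + (\<Sum>r\<in>{..?t} - {s}. ?term r)"
    by (simp only: diff_add_eq)
  then show ?case
    using dsubmodule_add [OF A top rest] by (simp only:)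
qed

end

section \<open>Independence of monomial operators\<close>

definition (in dmodule) monomial_operator :: "nat \<Rightarrow> (nat \<Rightarrow> nat) \<Rightarrow> monomial \<Rightarrow> 'm \<Rightarrow> 'm" where
  "monomial_operator n s b v =
     derivs [0..<n] (\<lambda>i. s i * lookup (div_monomial b s) i) (single (mod_monomial b s) 1 *s v)"

context prime_annihilator
begin

definition escape_derivs :: "nat \<Rightarrow> monomial \<Rightarrow> 'm \<Rightarrow> 'm" where
  "escape_derivs i q = derivs [i..<n] (\<lambda>j. escape_order j * lookup q j)"

sublocale escape_derivs: additive "escape_derivs i q" for i q
  unfolding escape_derivs_def by standard (rule derivs.add)

lemma escape_derivs_Suc:
  "i < n \<Longrightarrow> escape_derivs i q v = escape_derivs (Suc i) q (deriv i (escape_order i * lookup q i) v)"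
  by (simp add: escape_derivs_def upt_conv_Cons)

lemma escape_derivs_in_A: "v \<in> A \<Longrightarrow> escape_derivs i q v \<in> A"
  unfolding escape_derivs_def by (rule dsubmodule_derivs [OF A]) auto

lemma escape_derivs_scale_const:
  "g \<in> polys i \<Longrightarrow> escape_derivs i q (g *s v) = g *s escape_derivs i q v"
  unfolding escape_derivs_def by (rule derivs_scale_const) (auto intro: polys_mono)

lemma stripped_term_congruent:
  fixes g :: "'k mpoly"
  assumes "i < n" and g: "g \<in> P" "g \<in> polys (Suc i)" and "k \<in> polys n"
    and Q: "lookup q i \<le> Q" "escape_order i = 0 \<Longrightarrow> Q = 0"
  defines "c \<equiv> signed_dpart i (escape_order i) g"
  shows "g ^ Q *s deriv i (escape_order i * lookup q i) (k *s w)
      - (if lookup q i = Q then (c ^ Q * k) *s w else 0) \<in> A"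
proof -
  have below: "dpart i r g \<in> P" if "r < escape_order i" for r
    using g that by (intro dpart_in_P) auto
  show ?thesis
  proof (cases "lookup q i = Q")
    case True
    then show ?thesis
      unfolding c_def using power_strips_derivative [OF assms(1) g(1) below assms(4)] by simp
  next
    case False
    then have "escape_order i * lookup q i < escape_order i * Q"
      using Q by (metis gr0I le_neq_implies_less less_nat_zero_code mult_less_mono2)
    then show ?thesis
      using power_kills_low_order [OF assms(1) g(1) below assms(4)] False by simp
  qed
qed

lemma eliminate_variable:
  fixes k :: "monomial \<Rightarrow> 'k mpoly"
  assumes i: "i < n" and "finite I" and k: "\<And>q. q \<in> I \<Longrightarrow> k q \<in> polys n"
    and Q: "\<And>q. q \<in> I \<Longrightarrow> lookup q i \<le> Q" "escape_order i = 0 \<Longrightarrow> Q = 0"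
    and sum: "(\<Sum>q\<in>I. escape_derivs i q (k q *s w)) \<in> A"
  obtains c where "c \<in> polys n" "Q = 0 \<or> c \<notin> P"
    "(\<Sum>q\<in>{q \<in> I. lookup q i = Q}. escape_derivs (Suc i) q ((c ^ Q * k q) *s w)) \<in> A"
proof -
  obtain g where g: "g \<in> P" "g \<in> polys (Suc i)"
      "escape_order i = 0 \<or> dpart i (escape_order i) g \<notin> P"
    using escape_witness by blast
  define c where "c = signed_dpart i (escape_order i) g"
  let ?stripped = "\<lambda>q. g ^ Q *s deriv i (escape_order i * lookup q i) (k q *s w)"
  let ?top = "\<lambda>q. if lookup q i = Q then (c ^ Q * k q) *s w else 0"
  have "?stripped q - ?top q \<in> A" if "q \<in> I" for q
    unfolding c_def using that by (intro stripped_term_congruent i g(1,2) k Q)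
  then have congruent: "(\<Sum>q\<in>I. escape_derivs (Suc i) q (?stripped q)) \<in> A \<longleftrightarrow>
      (\<Sum>q\<in>I. escape_derivs (Suc i) q (?top q)) \<in> A"
    by (intro dsubmodule_sum_congruent [OF A])
      (simp only: escape_derivs_in_A flip: escape_derivs.diff)
  have "g ^ Q *s (\<Sum>q\<in>I. escape_derivs i q (k q *s w)) =
      (\<Sum>q\<in>I. escape_derivs (Suc i) q (?stripped q))"
    unfolding scale_sum_right escape_derivs_Suc [OF i]
    by (intro sum.cong refl escape_derivs_scale_const [symmetric] polys_power g)
  then have "(\<Sum>q\<in>I. escape_derivs (Suc i) q (?stripped q)) \<in> A"
    using dsubmodule_scale [OF A polys_power [OF P_polys [OF g(1)]] sum, of Q] by (simp only:)
  then have "(\<Sum>q\<in>I. escape_derivs (Suc i) q (?top q)) \<in> A"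
    by (rule iffD1 [OF congruent])
  also have "(\<Sum>q\<in>I. escape_derivs (Suc i) q (?top q)) =
      (\<Sum>q\<in>{q \<in> I. lookup q i = Q}. escape_derivs (Suc i) q ((c ^ Q * k q) *s w))"
    using \<open>finite I\<close> by (intro sum.mono_neutral_cong_right) (auto simp: escape_derivs.zero)
  finally show thesis
    using that [of c] g Q(2) by (auto simp: c_def signed_dpart_in_P_iff P_polys polys_signed_dpart)
qed

lemma discard_terms_in_P:
  assumes "finite I" "\<And>q. q \<in> I \<Longrightarrow> k q \<in> polys n"
    and sum: "(\<Sum>q\<in>I. escape_derivs i q (k q *s w)) \<in> A"
  shows "(\<Sum>q\<in>{q \<in> I. k q \<notin> P}. escape_derivs i q (k q *s w)) \<in> A"
proof -
  let ?I = "{q \<in> I. k q \<notin> P}"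
  have "(\<Sum>q\<in>I - ?I. escape_derivs i q (k q *s w)) \<in> A"
    by (intro dsubmodule_sum [OF A] escape_derivs_in_A) (simp add: annihilator_iff assms)
  moreover have "(\<Sum>q\<in>I. escape_derivs i q (k q *s w)) =
      (\<Sum>q\<in>I - ?I. escape_derivs i q (k q *s w)) + (\<Sum>q\<in>?I. escape_derivs i q (k q *s w))"
    using \<open>finite I\<close> by (intro sum.subset_diff) auto
  ultimately show ?thesis
    using dsubmodule_diff [OF A sum, of "\<Sum>q\<in>I - ?I. escape_derivs i q (k q *s w)"] by simp
qed

definition escape_exponents :: "monomial set" where
  "escape_exponents = {q \<in> monomials n. \<forall>j. escape_order j = 0 \<longrightarrow> lookup q j = 0}"

lemma eliminate_top_exponent:
  assumes "i < n" "finite I" "I \<subseteq> escape_exponents" "q \<in> I" "k q \<notin> P"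
    and k: "\<And>q. q \<in> I \<Longrightarrow> k q \<in> polys n"
    and sum: "(\<Sum>q\<in>I. escape_derivs i q (k q *s w)) \<in> A"
  obtains q1 c where "q1 \<in> I" "k q1 \<notin> P" "c \<in> polys n" "lookup q1 i = 0 \<or> c \<notin> P"
    "(\<Sum>q\<in>{q \<in> {q \<in> I. k q \<notin> P}. lookup q i = lookup q1 i}.
        escape_derivs (Suc i) q ((c ^ lookup q1 i * k q) *s w)) \<in> A"
proof -
  let ?J = "{q \<in> I. k q \<notin> P}"
  have J: "finite ?J" "?J \<noteq> {}"
    using assms(2,4,5) by auto
  obtain q1 where q1: "q1 \<in> ?J" and "(MAX q\<in>?J. lookup q i) = lookup q1 i"
    using obtains_MAX [OF J] by blast
  then have max: "lookup q i \<le> lookup q1 i" if "q \<in> ?J" for q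
    using that J(1) by (metis (no_types, lifting) Max_ge finite_imageI imageI)
  have zero: "lookup q1 i = 0" if "escape_order i = 0"
    using that q1 assms(3) by (auto simp: escape_exponents_def)
  have q1_in: "q1 \<in> I" "k q1 \<notin> P" and k_polys: "\<And>q. q \<in> ?J \<Longrightarrow> k q \<in> polys n"
    using q1 k by auto
  have "(\<Sum>q\<in>?J. escape_derivs i q (k q *s w)) \<in> A"
    using assms(2) k sum by (rule discard_terms_in_P)
  from eliminate_variable [OF assms(1) J(1) k_polys max zero this] show thesis
    using that [OF q1_in] by blast
qed

lemma coefficients_in_P:
  assumes "i \<le> n" "finite I" "I \<subseteq> escape_exponents"
    and "\<And>q q' j. q \<in> I \<Longrightarrow> q' \<in> I \<Longrightarrow> j < i \<Longrightarrow> lookup q j = lookup q' j"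
    and "\<And>q. q \<in> I \<Longrightarrow> k q \<in> polys n"
    and "(\<Sum>q\<in>I. escape_derivs i q (k q *s w)) \<in> A"
    and "q \<in> I"
  shows "k q \<in> P"
  using assms
proof (induction i arbitrary: I k q rule: inc_induct)
  case base
  have "q' = q" if "q' \<in> I" for q'
    using base.prems(2,3,6) that unfolding escape_exponents_def
    by (intro monomials_eqI [of _ n]) blast+
  then have "I = {q}"
    using base.prems(6) by blast
  then show ?case
    using base.prems by (simp add: annihilator_iff escape_derivs_def)
next
  case (step i)
  show ?case
  proof (rule ccontr)
    assume "k q \<notin> P"
    with step obtain q1 c where q1: "q1 \<in> I" "k q1 \<notin> P"
      and c: "c \<in> polys n" "lookup q1 i = 0 \<or> c \<notin> P"
      and sum: "(\<Sum>q\<in>{q \<in> {q \<in> I. k q \<notin> P}. lookup q i = lookup q1 i}.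
        escape_derivs (Suc i) q ((c ^ lookup q1 i * k q) *s w)) \<in> A"
      by (elim eliminate_top_exponent)
    let ?top = "{q \<in> {q \<in> I. k q \<notin> P}. lookup q i = lookup q1 i}"
    have "c ^ lookup q1 i * k q1 \<in> P"
    proof (rule step.IH [OF _ _ _ _ sum])
      show "lookup q j = lookup q' j" if "q \<in> ?top" "q' \<in> ?top" "j < Suc i" for q q' j
        using that step.prems(3) [of q q' j] by (cases "j = i") auto
      show "c ^ lookup q1 i * k q \<in> polys n" if "q \<in> ?top" for q
        using that step.prems(4) c(1) by (intro polys_mult polys_power) auto
    qed (use step.prems(1,2) q1 in auto)
    then have "k q1 \<in> P"
      using step.prems(4) [OF q1(1)] c by (intro P_prime_power [of c "k q1" "lookup q1 i"])
    with q1(2) show False by contradiction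
  qed
qed

end

definition remainder_poly ::
    "(nat \<Rightarrow> nat) \<Rightarrow> (monomial \<Rightarrow> 'k::field) \<Rightarrow> monomial set \<Rightarrow> monomial \<Rightarrow> 'k mpoly" where
  "remainder_poly s c I q = (\<Sum>b | b \<in> I \<and> div_monomial b s = q. single (mod_monomial b s) (c b))"

lemma keys_remainder_poly:
  assumes "m \<in> keys (remainder_poly s c I q)"
  obtains b where "b \<in> I" "m = mod_monomial b s"
  using assms keys_sum [of "\<lambda>b. single (mod_monomial b s) (c b)" "{b \<in> I. div_monomial b s = q}"]
  unfolding remainder_poly_def by (fastforce split: if_splits)

lemma lookup_remainder_poly:
  assumes "finite I" "b \<in> I"
  shows "lookup (remainder_poly s c I (div_monomial b s)) (mod_monomial b s) = c b"
proof -
  have "lookup (remainder_poly s c I (div_monomial b s)) (mod_monomial b s) =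
      (\<Sum>b' | b' \<in> I \<and> div_monomial b' s = div_monomial b s. if b' = b then c b else 0)"
    unfolding remainder_poly_def lookup_sum lookup_single
    by (intro sum.cong refl) (auto simp: when_def dest: monomial_eqI_div_mod)
  then show ?thesis
    using assms by simp
qed

lemma remainder_poly_in_polys: "I \<subseteq> monomials n \<Longrightarrow> remainder_poly s c I q \<in> polys n"
  unfolding remainder_poly_def by (intro polys_sum polys_single mod_monomial_in_monomials) auto

context prime_annihilator
begin

lemma sum_monomial_operator_eq:
  assumes "finite I"
  shows "(\<Sum>b\<in>I. single 0 (c b) *s monomial_operator n escape_order b w) =
    (\<Sum>q\<in>(\<lambda>b. div_monomial b escape_order) ` I.
      escape_derivs 0 q (remainder_poly escape_order c I q *s w))"
proof -
  let ?div = "\<lambda>b. div_monomial b escape_order" and ?mod = "\<lambda>b. mod_monomial b escape_order"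
  have "single 0 (c b) *s monomial_operator n escape_order b w =
      escape_derivs 0 (?div b) (single (?mod b) (c b) *s w)" for b
  proof -
    have "single (?mod b) (c b) *s w = single 0 (c b) *s (single (?mod b) 1 *s w)"
      by (simp add: mult_single)
    then show ?thesis
      using escape_derivs_scale_const [of "single 0 (c b)" 0]
      unfolding monomial_operator_def escape_derivs_def by (simp only: polys_const)
  qed
  then have "(\<Sum>b\<in>I. single 0 (c b) *s monomial_operator n escape_order b w) =
      (\<Sum>q\<in>?div ` I. \<Sum>b | b \<in> I \<and> ?div b = q. escape_derivs 0 q (single (?mod b) (c b) *s w))"
    by (subst sum.image_gen [OF assms, of _ ?div]) (auto intro!: sum.cong)
  then show ?thesis
    by (simp add: remainder_poly_def scale_sum_left escape_derivs.sum)
qed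

lemma monomial_operator_independent:
  assumes "finite I" "I \<subseteq> monomials n"
  shows "independent_modulo const_scale A (\<lambda>b. monomial_operator n escape_order b w) I"
proof (rule independent_moduloI)
  fix c b
  assume sum: "(\<Sum>b\<in>I. single 0 (c b) *s monomial_operator n escape_order b w) \<in> A" and "b \<in> I"
  let ?k = "remainder_poly escape_order c I"
  let ?q = "div_monomial b escape_order"
  have "?k ?q \<in> P"
  proof (rule coefficients_in_P)
    show "(\<Sum>q\<in>(\<lambda>b. div_monomial b escape_order) ` I. escape_derivs 0 q (?k q *s w)) \<in> A"
      using sum unfolding sum_monomial_operator_eq [OF \<open>finite I\<close>] .
    show "(\<lambda>b. div_monomial b escape_order) ` I \<subseteq> escape_exponents"
      using assms(2) by (auto simp: escape_exponents_def div_monomial_in_monomials)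
  qed (use \<open>b \<in> I\<close> assms in \<open>auto intro: remainder_poly_in_polys\<close>)
  then have "?k ?q = 0"
  proof (rule reduced_in_P_eq_0 [rotated])
    fix m i assume "m \<in> keys (?k ?q)"
    then obtain b' where "m = mod_monomial b' escape_order"
      by (rule keys_remainder_poly)
    then show "escape_order i = 0 \<or> lookup m i < escape_order i"
      by (cases "escape_order i = 0") simp_all
  qed (rule remainder_poly_in_polys [OF assms(2)])
  then show "c b = 0"
    using lookup_remainder_poly [OF assms(1) \<open>b \<in> I\<close>, of escape_order c] by simp
qed

end

context dmodule
begin

lemma ex_prime_annihilator:
  assumes A: "dsubmodule n A" and B: "dsubmodule n B" and "A \<subset> B"
  obtains w where "w \<in> B" "prime_annihilator scale deriv n A w"
proof -
  let ?larger = "inv_image {(J, I). polys_ideal n I \<and> polys_ideal n J \<and> I \<subset> J} (annihilator n A)"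
  obtain w0 where "w0 \<in> B - A"
    using \<open>A \<subset> B\<close> by blast
  then obtain w where w: "w \<in> B - A" and min: "\<And>v. (v, w) \<in> ?larger \<Longrightarrow> v \<notin> B - A"
    by (rule wfE_min [OF wf_inv_image [OF wf_polys_ideals [of n], of "annihilator n A"]]) blast
  have maximal: "annihilator n A (g *s w) = annihilator n A w"
    if g: "g \<in> polys n" "g *s w \<notin> A" for g
  proof (rule ccontr)
    assume "annihilator n A (g *s w) \<noteq> annihilator n A w"
    then have "(g *s w, w) \<in> ?larger"
      using annihilator_scale_superset [OF A g(1)] polys_ideal_annihilator [OF A] by auto
    then show False
      using min dsubmodule_scale [OF B g(1)] w g(2) by blast
  qed
  have "prime_annihilator scale deriv n A w"
  proof
    fix g h assume gh: "g \<in> polys n" "h \<in> polys n" "(g * h) *s w \<in> A" "g *s w \<notin> A"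
    then have "h \<in> annihilator n A (g *s w)"
      by (simp add: annihilator_iff mult.commute)
    then show "h *s w \<in> A"
      using maximal [OF gh(1,4)] by (simp add: annihilator_iff)
  qed (use A w in auto)
  then show thesis
    using that w by blast
qed

theorem ex_independent_monomial_operators:
  assumes "dsubmodule n A" "dsubmodule n B" "A \<subset> B"
  obtains w s where "w \<in> B" "\<And>I. finite I \<Longrightarrow> I \<subseteq> monomials n \<Longrightarrow>
    independent_modulo const_scale A (\<lambda>b. monomial_operator n s b w) I"
  using ex_prime_annihilator [OF assms] prime_annihilator.monomial_operator_independent by metis

lemma monomial_operator_in_dsubmodule:
  "dsubmodule n B \<Longrightarrow> w \<in> B \<Longrightarrow> b \<in> monomials n \<Longrightarrow> monomial_operator n s b w \<in> B"
  unfolding monomial_operator_def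
  by (intro dsubmodule_derivs dsubmodule_scale polys_single mod_monomial_in_monomials) auto

definition dsubmodule_chain :: "nat \<Rightarrow> (nat \<Rightarrow> 'm set) \<Rightarrow> nat \<Rightarrow> bool" where
  "dsubmodule_chain n N l \<longleftrightarrow> (\<forall>m\<le>l. dsubmodule n (N m)) \<and> (\<forall>m<l. N m \<subset> N (Suc m))"

lemma dsubmodule_chainD:
  assumes "dsubmodule_chain n N l"
  shows dsubmodule_chain_dsubmodule: "m \<le> l \<Longrightarrow> dsubmodule n (N m)"
    and dsubmodule_chain_strict: "m < l \<Longrightarrow> N m \<subset> N (Suc m)"
  using assms unfolding dsubmodule_chain_def by blast+

lemma dsubmodule_chain_mono:
  assumes "dsubmodule_chain n N l" "m \<le> m'" "m' \<le> l"
  shows "N m \<subseteq> N m'"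
  by (rule lift_Suc_mono_le_ivl [of "{..<l}" N])
    (use assms dsubmodule_chain_strict [OF assms(1)] in auto)

lemma dsubmodule_chain_prepend_zero:
  assumes "dsubmodule_chain n N l" "N 0 \<noteq> {0}"
  shows "dsubmodule_chain n (case_nat {0} N) (Suc l)"
  unfolding dsubmodule_chain_def
proof (intro conjI allI impI)
  have zero: "dsubmodule n {0}"
    by (rule dsubmoduleI) (auto simp: deriv.zero)
  show "dsubmodule n (case_nat {0} N m)" if "m \<le> Suc l" for m
    using that zero dsubmodule_chain_dsubmodule [OF assms(1)] by (cases m) auto
  show "case_nat {0} N m \<subset> case_nat {0} N (Suc m)" if "m < Suc l" for m
    using that dsubmodule_chain_strict [OF assms(1)] assms(2)
      dsubmodule_zero [OF dsubmodule_chain_dsubmodule [OF assms(1), of 0]]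
    by (cases m) auto
qed

end

section \<open>Counting monomials\<close>

lemma inj_on_restrict_lookup: "inj_on (\<lambda>m. restrict (lookup m) {..<n}) (monomials n)"
  by (rule inj_onI, erule (1) monomials_eqI) (metis lessThan_iff restrict_apply')

lemma finite_monomials_upto: "finite (monomials_upto n j)"
  and card_monomials_upto_le: "card (monomials_upto n j) \<le> (j + 1) ^ n"
proof -
  let ?exponents = "{..<n} \<rightarrow>\<^sub>E {..j}"
  have "finite ?exponents"
    by (intro finite_PiE) auto
  moreover have "inj_on (\<lambda>m. restrict (lookup m) {..<n}) (monomials_upto n j)"
    using inj_on_restrict_lookup by (rule inj_on_subset) (auto simp: monomials_upto_def)
  moreover have "(\<lambda>m. restrict (lookup m) {..<n}) ` monomials_upto n j \<subseteq> ?exponents"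
    by (auto simp: monomials_upto_def intro: order_trans [OF lookup_le_monomial_degree]
        split: if_splits)
  ultimately show "finite (monomials_upto n j)" "card (monomials_upto n j) \<le> (j + 1) ^ n"
    using inj_on_finite card_inj_on_le [of _ "monomials_upto n j" ?exponents]
    by (blast, fastforce simp: card_PiE)
qed

lemma div_monomial_in_monomials_upto:
  assumes "m \<in> monomials_upto n (d * j)" "d > 0"
  shows "div_monomial m (\<lambda>_. d) \<in> monomials_upto n j"
proof -
  let ?q = "div_monomial m (\<lambda>_. d)"
  have monomials: "m \<in> monomials n" "?q \<in> monomials n"
    using assms by (simp_all add: monomials_upto_def div_monomial_in_monomials)
  have "d * monomial_degree ?q = (\<Sum>i<n. d * (lookup m i div d))"
    by (simp add: monomial_degree_monomials [OF monomials(2)] sum_distrib_left)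
  also have "\<dots> \<le> monomial_degree m"
    unfolding monomial_degree_monomials [OF monomials(1)]
    by (intro sum_mono times_div_less_eq_dividend)
  also have "\<dots> \<le> d * j"
    using assms by (simp add: monomials_upto_def)
  finally show ?thesis
    using assms(2) monomials by (simp add: monomials_upto_def)
qed

lemma card_monomials_upto_mult_le:
  assumes "d > 0"
  shows "card (monomials_upto n (d * j)) \<le> d ^ n * card (monomials_upto n j)"
proof -
  let ?target = "({..<n} \<rightarrow>\<^sub>E {..<d}) \<times> monomials_upto n j"
  let ?mod = "\<lambda>m. mod_monomial m (\<lambda>_. d)" and ?div = "\<lambda>m. div_monomial m (\<lambda>_. d)"
  let ?F = "\<lambda>m. (restrict (lookup (?mod m)) {..<n}, ?div m)"
  have "card (monomials_upto n (d * j)) \<le> card ?target"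
  proof (rule card_inj_on_le [of ?F])
    show "inj_on ?F (monomials_upto n (d * j))"
    proof (rule inj_onI)
      fix a b assume ab: "a \<in> monomials_upto n (d * j)" "b \<in> monomials_upto n (d * j)" "?F a = ?F b"
      then have "?mod a = ?mod b"
        by (intro inj_onD [OF inj_on_restrict_lookup [of n]])
          (auto simp: monomials_upto_def intro: mod_monomial_in_monomials)
      with ab(3) show "a = b"
        by (auto intro: monomial_eqI_div_mod)
    qed
    show "?F ` monomials_upto n (d * j) \<subseteq> ?target"
      using assms div_monomial_in_monomials_upto
      by (intro image_subsetI) (simp add: restrict_PiE_iff)
    show "finite ?target"
      by (intro finite_cartesian_product finite_PiE finite_monomials_upto) auto
  qed
  then show ?thesis
    by (simp add: card_cartesian_product card_PiE)
qed

lemma ex_exponential_gt_polynomial: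
  fixes a :: real
  assumes "a > 1"
  obtains k where "real (k * c + 1) ^ n < a ^ k"
proof -
  have "real c + 1 > 0"
    by simp
  then have "\<forall>\<^sub>F k in sequentially. (real k * (real c + 1) + 1) ^ n < a ^ k"
    using assms by real_asymp
  then obtain k where "(real k * (real c + 1) + 1) ^ n < a ^ k"
    using eventually_happens by fastforce
  moreover have "real (k * c + 1) ^ n \<le> (real k * (real c + 1) + 1) ^ n"
    by (intro power_mono) (simp_all add: algebra_simps)
  ultimately show thesis
    using that by (blast intro: le_less_trans)
qed

lemma iterate_growth:
  fixes N :: "nat \<Rightarrow> nat"
  assumes "\<And>j. a * N j \<le> b * N (j + c)"
  shows "a ^ k * N 0 \<le> b ^ k * N (k * c)"
proof (induction k)
  case (Suc k)
  have "a ^ Suc k * N 0 \<le> a * (b ^ k * N (k * c))"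
    using mult_le_mono2 [OF Suc, of a] by (simp only: power_Suc mult.assoc)
  also have "\<dots> = b ^ k * (a * N (k * c))"
    by (simp only: mult.left_commute)
  also have "\<dots> \<le> b ^ k * (b * N (k * c + c))"
    by (intro mult_le_mono2 assms)
  finally show ?case
    by (simp add: algebra_simps)
qed simp

lemma polynomial_growth_bound:
  fixes N :: "nat \<Rightarrow> nat"
  assumes growth: "\<And>j. l * N j \<le> e * N (j + c)" and bound: "\<And>j. N j \<le> (j + 1) ^ n"
    and "N 0 > 0"
  shows "l \<le> e"
proof (rule ccontr)
  assume "\<not> l \<le> e"
  then have step: "(e + 1) * N j \<le> e * N (j + c)" for j
    using growth [of j] mult_le_mono1 [of "e + 1" l "N j"] by simp
  then have "e > 0"
    using \<open>N 0 > 0\<close> by (cases e) (use step [of 0] in auto)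

  have "(e + 1) ^ k \<le> e ^ k * (k * c + 1) ^ n" for k
  proof -
    have "(e + 1) ^ k \<le> (e + 1) ^ k * N 0"
      using \<open>N 0 > 0\<close> by simp
    also note iterate_growth [of "e + 1" N e c, OF step]
    also have "e ^ k * N (k * c) \<le> e ^ k * (k * c + 1) ^ n"
      using bound by (intro mult_le_mono2)
    finally show ?thesis .
  qed
  then have real_bound: "real ((e + 1) ^ k) \<le> real (e ^ k * (k * c + 1) ^ n)" for k
    by (simp only: of_nat_le_iff)
  have "((real e + 1) / real e) ^ k \<le> real (k * c + 1) ^ n" for k
    using \<open>e > 0\<close> real_bound [of k] by (simp add: power_divide field_simps)
  moreover obtain k where "real (k * c + 1) ^ n < ((real e + 1) / real e) ^ k"
    using ex_exponential_gt_polynomial [of "(real e + 1) / real e"] \<open>e > 0\<close> by auto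
  ultimately show False
    by (metis linorder_not_le)
qed

section \<open>Filtrations\<close>

locale filtered_dmodule = dmodule scale deriv
  for scale :: "'k::field mpoly \<Rightarrow> 'm::ab_group_add \<Rightarrow> 'm" (infixr \<open>*s\<close> 75) and deriv +
  fixes n :: nat and V :: "nat \<Rightarrow> 'm set"
  assumes mono_V: "mono V"
    and deriv_V: "i < n \<Longrightarrow> v \<in> V j \<Longrightarrow> deriv i t v \<in> V (j + t)"
    and scale_V: "m \<in> monomials n \<Longrightarrow> v \<in> V j \<Longrightarrow> single m 1 *s v \<in> V (j + monomial_degree m)"
begin

lemma derivs_V: "set js \<subseteq> {..<n} \<Longrightarrow> v \<in> V j \<Longrightarrow> derivs js e v \<in> V (j + sum_list (map e js))"
proof (induction js arbitrary: v j)
  case (Cons i js)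
  then show ?case
    using Cons.IH [OF _ deriv_V [of i v j "e i"]] by (simp add: add.assoc)
qed simp

lemma monomial_operator_V:
  assumes "w \<in> V c" and b: "b \<in> monomials_upto n j"
  shows "monomial_operator n s b w \<in> V (j + c)"
proof -
  have "b \<in> monomials n"
    using b by (simp add: monomials_upto_def)
  note mod = mod_monomial_in_monomials [OF this]
  have "monomial_degree b = monomial_degree (mod_monomial b s) +
      sum_list (map (\<lambda>i. s i * lookup (div_monomial b s) i) [0..<n])"
    unfolding monomial_degree_monomials [OF \<open>b \<in> monomials n\<close>] monomial_degree_monomials [OF mod]
    by (simp add: interv_sum_list_conv_sum_set_nat atLeast0LessThan flip: sum.distrib)
  moreover have "set [0..<n] \<subseteq> {..<n}"
    by auto
  ultimately have "monomial_operator n s b w \<in> V (c + monomial_degree b)"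
    using derivs_V [OF _ scale_V [OF mod assms(1)]]
    unfolding monomial_operator_def by (simp only: add.assoc)
  moreover have "V (c + monomial_degree b) \<subseteq> V (j + c)"
    using b by (intro monoD [OF mono_V]) (simp add: monomials_upto_def)
  ultimately show ?thesis
    by blast
qed

lemma chain_generators:
  assumes chain: "dsubmodule_chain n N l" and "N l \<subseteq> (\<Union>j. V j)"
  obtains w s c where "\<And>m. m < l \<Longrightarrow> w m \<in> N (Suc m)" "\<And>m. m < l \<Longrightarrow> w m \<in> V c"
    "\<And>m I. m < l \<Longrightarrow> finite I \<Longrightarrow> I \<subseteq> monomials n \<Longrightarrow>
      independent_modulo const_scale (N m) (\<lambda>b. monomial_operator n (s m) b (w m)) I"
proof -
  define generates where "generates m w s \<longleftrightarrow> w \<in> N (Suc m) \<and>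
    (\<forall>I. finite I \<longrightarrow> I \<subseteq> monomials n \<longrightarrow>
      independent_modulo const_scale (N m) (\<lambda>b. monomial_operator n s b w) I)" for m w s
  have "\<exists>w s j. generates m w s \<and> w \<in> V j" if m: "m < l" for m
  proof (rule ex_independent_monomial_operators)
    fix w s assume "w \<in> N (Suc m)" and "\<And>I. finite I \<Longrightarrow> I \<subseteq> monomials n \<Longrightarrow>
      independent_modulo const_scale (N m) (\<lambda>b. monomial_operator n s b w) I"
    moreover from this(1) obtain j where "w \<in> V j"
      using assms(2) dsubmodule_chain_mono [OF chain, of "Suc m" l] m by auto
    ultimately show ?thesis
      unfolding generates_def by blast
  qed (use m dsubmodule_chainD [OF chain] in auto)
  then obtain w s j where generates: "\<And>m. m < l \<Longrightarrow> generates m (w m) (s m)"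
    and w_in_V: "\<And>m. m < l \<Longrightarrow> w m \<in> V (j m)"
    by metis
  have "w m \<in> V (\<Sum>m<l. j m)" if "m < l" for m
  proof -
    have "j m \<le> (\<Sum>m<l. j m)"
      using that by (intro member_le_sum) auto
    then show ?thesis
      using monoD [OF mono_V] w_in_V [OF that] by blast
  qed
  then show thesis
    using that generates unfolding generates_def by blast
qed

lemma chain_card_le:
  assumes chain: "dsubmodule_chain n N l" and exhaust: "N l \<subseteq> (\<Union>j. V j)"
  obtains c where "\<And>j T. finite T \<Longrightarrow> V (j + c) \<subseteq> vs.span T \<Longrightarrow>
    l * card (monomials_upto n j) \<le> card T"
proof -
  obtain w s c where w: "\<And>m. m < l \<Longrightarrow> w m \<in> N (Suc m)" "\<And>m. m < l \<Longrightarrow> w m \<in> V c"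
    and ind: "\<And>m I. m < l \<Longrightarrow> finite I \<Longrightarrow> I \<subseteq> monomials n \<Longrightarrow>
      independent_modulo const_scale (N m) (\<lambda>b. monomial_operator n (s m) b (w m)) I"
    by (rule chain_generators [OF chain exhaust]) (rule that)
  let ?u = "\<lambda>(m, b). monomial_operator n (s m) b (w m)"
  have "l * card (monomials_upto n j) \<le> card T" if T: "finite T" "V (j + c) \<subseteq> vs.span T" for j T
  proof -
    let ?B = "monomials_upto n j"
    have N: "dsubmodule n (N m)" if "m \<le> l" for m
      using that by (rule dsubmodule_chain_dsubmodule [OF chain])
    have "independent_modulo const_scale (N 0) ?u ({..<l} \<times> ?B)"
    proof (rule vs.independent_modulo_chain)
      show "vs.subspace (N m)" if "m \<le> l" for m
        using N [OF that] by (rule subspace_dsubmodule)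
      show "monomial_operator n (s m) b (w m) \<in> N (Suc m)" if "m < l" "b \<in> ?B" for m b
        using that w(1) N [of "Suc m"]
        by (intro monomial_operator_in_dsubmodule) (auto simp: monomials_upto_def)
      show "independent_modulo const_scale (N m)
          (\<lambda>b. monomial_operator n (s m) b (w m)) ?B" if "m < l" for m
        using that by (intro ind finite_monomials_upto) (auto simp: monomials_upto_def)
    qed (use dsubmodule_chain_strict [OF chain] finite_monomials_upto in auto)
    moreover have "?u (m, b) \<in> V (j + c)" if "m < l" "b \<in> ?B" for m b
      using monomial_operator_V [OF w(2)] that by simp
    ultimately have "card ({..<l} \<times> ?B) \<le> card T"
      using dsubmodule_zero [OF N] T
      by (intro vs.independent_modulo_card_le) (auto intro: finite_monomials_upto)
    then show ?thesis
      by (simp add: card_cartesian_product)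
  qed
  then show thesis
    by (rule that)
qed

theorem dsubmodule_chain_length_le:
  assumes "dsubmodule_chain n N l" "N l \<subseteq> (\<Union>j. V j)"
    and T: "\<And>j. finite (T j)" "\<And>j. V j \<subseteq> vs.span (T j)"
      "\<And>j. card (T j) \<le> e * card (monomials_upto n j)"
  shows "l \<le> e"
proof -
  obtain c where "\<And>j T. finite T \<Longrightarrow> V (j + c) \<subseteq> vs.span T \<Longrightarrow>
      l * card (monomials_upto n j) \<le> card T"
    using chain_card_le [OF assms(1,2)] by blast
  then have "l * card (monomials_upto n j) \<le> e * card (monomials_upto n (j + c))" for j
    using T by (meson order_trans)
  moreover have "card (monomials_upto n 0) > 0"
    using finite_monomials_upto zero_in_monomials_upto by (metis card_gt_0_iff empty_iff)
  ultimately show ?thesis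
    using card_monomials_upto_le
    by (intro polynomial_growth_bound [of l "\<lambda>j. card (monomials_upto n j)" e c n])
qed

end

section \<open>Divided derivatives on the fraction field\<close>

lemma to_fract_power: "to_fract (g ^ t) = to_fract g ^ t"
  by (induction t) simp_all

lemma to_fract_sum: "to_fract (sum g S) = (\<Sum>x\<in>S. to_fract (g x))"
  by (induction S rule: infinite_finite_induct) simp_all

text \<open>The Taylor expansion \<open>h(x\<^sub>i + T)\<close> is a ring homomorphism into the power series in \<open>T\<close> that
  maps a nonzero \<open>h\<close> to a series with constant term \<open>h\<close>, which is invertible over the fraction
  field. Hence it extends to that field, and its coefficients are the divided derivatives there.\<close>

definition taylor_poly :: "nat \<Rightarrow> 'k::field mpoly \<Rightarrow> 'k mpoly fract fps" where
  "taylor_poly i g = Abs_fps (\<lambda>t. to_fract (dpart i t g))"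

lemma taylor_poly_nth [simp]: "fps_nth (taylor_poly i g) t = to_fract (dpart i t g)"
  by (simp add: taylor_poly_def)

lemma taylor_poly_add: "taylor_poly i (g + h) = taylor_poly i g + taylor_poly i h"
  by (rule fps_ext) (simp add: dpart_add)

lemma taylor_poly_mult: "taylor_poly i (g * h) = taylor_poly i g * taylor_poly i h"
  by (rule fps_ext) (simp add: fps_mult_nth dpart_mult to_fract_sum atLeast0AtMost)

lemma taylor_poly_one: "taylor_poly i 1 = 1"
  by (rule fps_ext) (simp add: dpart_one)

lemma taylor_poly_nonzero: "g \<noteq> 0 \<Longrightarrow> taylor_poly i g \<noteq> 0"
  by (metis dpart_order_zero to_fract_eq_0_iff fps_zero_nth taylor_poly_nth)

definition taylor :: "nat \<Rightarrow> 'k::field mpoly fract \<Rightarrow> 'k mpoly fract fps" where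
  "taylor i h = (THE X. \<forall>g F. F \<noteq> 0 \<longrightarrow> h = Fract g F \<longrightarrow> X * taylor_poly i F = taylor_poly i g)"

lemma taylor_eqI:
  assumes F: "F \<noteq> 0" and X: "X * taylor_poly i F = taylor_poly i g"
  shows "taylor i (Fract g F) = X"
  unfolding taylor_def
proof (intro the_equality allI impI)
  fix g' F' assume F': "F' \<noteq> 0" "Fract g F = Fract g' F'"
  have "X * taylor_poly i F' * taylor_poly i F = taylor_poly i (g * F')"
    by (simp add: taylor_poly_mult mult_ac flip: X)
  also have "\<dots> = taylor_poly i g' * taylor_poly i F"
    using F F' by (simp add: eq_fract taylor_poly_mult)
  finally show "X * taylor_poly i F' = taylor_poly i g'"
    using taylor_poly_nonzero [OF F] by simp
next
  fix Y
  assume "\<forall>g' F'. F' \<noteq> 0 \<longrightarrow> Fract g F = Fract g' F' \<longrightarrow> Y * taylor_poly i F' = taylor_poly i g'"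
  then have "Y * taylor_poly i F = X * taylor_poly i F"
    using F X by simp
  then show "Y = X"
    using taylor_poly_nonzero [OF F] by simp
qed

lemma taylor_Fract:
  assumes "F \<noteq> 0"
  shows "taylor i (Fract g F) * taylor_poly i F = taylor_poly i g"
proof -
  have "inverse (taylor_poly i F) * taylor_poly i F = 1"
    using assms by (intro inverse_mult_eq_1) simp
  then have "(taylor_poly i g * inverse (taylor_poly i F)) * taylor_poly i F = taylor_poly i g"
    by (simp add: mult.assoc)
  then show ?thesis
    using taylor_eqI [OF assms] by metis
qed

lemma taylor_add: "taylor i (h + h') = taylor i h + taylor i h'"
proof (cases h, cases h')
  fix g F g' F'
  assume Fract: "h = Fract g F" "F \<noteq> 0" "h' = Fract g' F'" "F' \<noteq> 0"
  have "(taylor i h + taylor i h') * taylor_poly i (F * F') =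
      (taylor i h * taylor_poly i F) * taylor_poly i F' +
      (taylor i h' * taylor_poly i F') * taylor_poly i F"
    by (simp add: taylor_poly_mult algebra_simps)
  also have "\<dots> = taylor_poly i (g * F' + g' * F)"
    using Fract by (simp add: taylor_Fract taylor_poly_mult taylor_poly_add)
  finally show ?thesis
    using Fract by (simp add: taylor_eqI)
qed

lemma taylor_mult: "taylor i (h * h') = taylor i h * taylor i h'"
proof (cases h, cases h')
  fix g F g' F'
  assume Fract: "h = Fract g F" "F \<noteq> 0" "h' = Fract g' F'" "F' \<noteq> 0"
  have "(taylor i h * taylor i h') * taylor_poly i (F * F') =
      (taylor i h * taylor_poly i F) * (taylor i h' * taylor_poly i F')"
    by (simp add: taylor_poly_mult algebra_simps)
  also have "\<dots> = taylor_poly i (g * g')"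
    using Fract by (simp add: taylor_Fract taylor_poly_mult)
  finally show ?thesis
    using Fract by (simp add: taylor_eqI)
qed

lemma taylor_to_fract: "taylor i (to_fract g) = taylor_poly i g"
  unfolding to_fract_def by (rule taylor_eqI) (simp_all add: taylor_poly_one)

definition fract_deriv :: "nat \<Rightarrow> nat \<Rightarrow> 'k::field mpoly fract \<Rightarrow> 'k mpoly fract" where
  "fract_deriv i t h = fps_nth (taylor i h) t"

lemma fract_deriv_to_fract: "fract_deriv i t (to_fract g) = to_fract (dpart i t g)"
  by (simp add: fract_deriv_def taylor_to_fract)

lemma fract_deriv_mult:
  "fract_deriv i t (h * h') = (\<Sum>a\<le>t. fract_deriv i a h * fract_deriv i (t - a) h')"
  by (simp add: fract_deriv_def taylor_mult fps_mult_nth atLeast0AtMost)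

lemma fract_deriv_order_zero: "fract_deriv i 0 h = h"
proof (cases h)
  case (Fract g F)
  then have "fract_deriv i 0 h * to_fract F = to_fract g"
    using arg_cong [OF taylor_Fract [of F i g], of "\<lambda>X. fps_nth X 0"]
    by (simp add: fract_deriv_def)
  also have "\<dots> = h * to_fract F"
    using Fract by (simp add: Fract_conv_to_fract)
  finally show ?thesis
    using Fract by simp
qed

definition fract_scale :: "'k::field mpoly \<Rightarrow> 'k mpoly fract \<Rightarrow> 'k mpoly fract" where
  "fract_scale g h = to_fract g * h"

interpretation fract: dmodule fract_scale fract_deriv
proof
  show "fract_deriv i t (u + v) = fract_deriv i t u + fract_deriv i t v"
    for i t and u v :: "'k::field mpoly fract"
    by (simp add: fract_deriv_def taylor_add)
  show "fract_deriv i t (fract_scale g v) =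
      (\<Sum>a\<le>t. fract_scale (dpart i a g) (fract_deriv i (t - a) v))"
    for i t and g :: "'k::field mpoly" and v
    by (simp add: fract_scale_def fract_deriv_mult fract_deriv_to_fract)
qed (simp_all add: fract_scale_def fract_deriv_order_zero algebra_simps)

lemma fract_deriv_mult_split:
  "fract_deriv i t (h * h') =
    h * fract_deriv i t h' + (\<Sum>a=1..t. fract_deriv i a h * fract_deriv i (t - a) h')"
  by (simp add: fract_deriv_mult fract_deriv_order_zero atMost_atLeast0 sum.atLeast_Suc_atMost)

lemma fract_deriv_inverse:
  assumes "h \<noteq> 0" "t > 0"
  shows "fract_deriv i t (1 / h) =
    (1 / h) * - (\<Sum>a=1..t. fract_deriv i a h * fract_deriv i (t - a) (1 / h))"
proof -
  have "0 = fract_deriv i t (h * (1 / h))"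
    using assms fract_deriv_to_fract [of i t 1] by (simp add: dpart_one)
  also note fract_deriv_mult_split
  finally show ?thesis
    using assms(1) by (simp add: field_simps eq_neg_iff_add_eq_0)
qed

section \<open>The filtration of the localization\<close>

definition fractions_upto :: "'k::field mpoly \<Rightarrow> nat \<Rightarrow> nat \<Rightarrow> nat \<Rightarrow> 'k mpoly fract set" where
  "fractions_upto f n j e = (\<lambda>g. to_fract g / to_fract f ^ j) ` polys_upto n e"

lemma fractions_upto_add:
  assumes "u \<in> fractions_upto f n j e" "v \<in> fractions_upto f n j e"
  shows "u + v \<in> fractions_upto f n j e"
proof -
  obtain g h where "g \<in> polys_upto n e" "h \<in> polys_upto n e"
    "u = to_fract g / to_fract f ^ j" "v = to_fract h / to_fract f ^ j"
    using assms by (auto simp: fractions_upto_def)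
  then show ?thesis
    unfolding fractions_upto_def
    by (intro image_eqI [of _ _ "g + h"] polys_upto_add) (simp_all add: add_divide_distrib)
qed

lemma fractions_upto_zero: "0 \<in> fractions_upto f n j e"
  by (auto simp: fractions_upto_def image_iff intro!: bexI [of _ 0])

lemma fractions_upto_uminus:
  assumes "v \<in> fractions_upto f n j e"
  shows "- v \<in> fractions_upto f n j e"
proof -
  obtain g where "g \<in> polys_upto n e" "v = to_fract g / to_fract f ^ j"
    using assms by (auto simp: fractions_upto_def)
  then show ?thesis
    unfolding fractions_upto_def by (intro image_eqI [of _ _ "- g"] polys_upto_uminus) simp_all
qed

lemma fractions_upto_sum:
  "(\<And>x. x \<in> S \<Longrightarrow> g x \<in> fractions_upto f n j e) \<Longrightarrow> sum g S \<in> fractions_upto f n j e"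
  by (induction S rule: infinite_finite_induct) (auto intro: fractions_upto_add fractions_upto_zero)

lemma fractions_upto_mult:
  assumes "u \<in> fractions_upto f n j e" "v \<in> fractions_upto f n j' e'"
  shows "u * v \<in> fractions_upto f n (j + j') (e + e')"
proof -
  obtain g h where "g \<in> polys_upto n e" "h \<in> polys_upto n e'"
    "u = to_fract g / to_fract f ^ j" "v = to_fract h / to_fract f ^ j'"
    using assms by (auto simp: fractions_upto_def)
  then show ?thesis
    unfolding fractions_upto_def
    by (intro image_eqI [of _ _ "g * h"] polys_upto_mult) (simp_all add: power_add)
qed

lemma fractions_upto_mono:
  "v \<in> fractions_upto f n j e \<Longrightarrow> e \<le> e' \<Longrightarrow> v \<in> fractions_upto f n j e'"
  by (auto simp: fractions_upto_def intro: polys_upto_mono)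

lemma fractions_upto_to_fract: "g \<in> polys_upto n e \<Longrightarrow> to_fract g \<in> fractions_upto f n 0 e"
  by (simp add: fractions_upto_def)

lemma fractions_upto_inverse: "1 / to_fract f \<in> fractions_upto f n 1 0"
  unfolding fractions_upto_def by (intro image_eqI [of _ _ 1]) simp_all

locale localization =
  fixes f :: "'k::field mpoly" and n d :: nat
  assumes f_nonzero: "f \<noteq> 0" and f_degree: "f \<in> polys_upto n d"
begin

lemma fractions_upto_raise:
  assumes "v \<in> fractions_upto f n j e"
  shows "v \<in> fractions_upto f n (j + a) (e + a * d)"
proof -
  have "1 \<in> fractions_upto f n a (a * d)"
    unfolding fractions_upto_def using f_nonzero f_degree
    by (intro image_eqI [of _ _ "f ^ a"] polys_upto_power) (simp_all add: to_fract_power)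
  from fractions_upto_mult [OF assms this] show ?thesis
    by simp
qed

definition derivs_bounded :: "nat \<Rightarrow> nat \<Rightarrow> 'k mpoly fract \<Rightarrow> bool" where
  "derivs_bounded j e h \<longleftrightarrow> (\<forall>i t. fract_deriv i t h \<in> fractions_upto f n (j + t) (e + t * d))"

lemma derivs_boundedD:
  "derivs_bounded j e h \<Longrightarrow> fract_deriv i t h \<in> fractions_upto f n (j + t) (e + t * d)"
  by (simp add: derivs_bounded_def)

lemma derivs_bounded_mult:
  assumes "derivs_bounded j e h" "derivs_bounded j' e' h'"
  shows "derivs_bounded (j + j') (e + e') (h * h')"
  unfolding derivs_bounded_def fract_deriv_mult
proof (intro allI fractions_upto_sum)
  fix i t a :: nat assume a: "a \<in> {..t}"
  have "(j + a) + (j' + (t - a)) = j + j' + t" "(e + a * d) + (e' + (t - a) * d) = e + e' + t * d"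
    using a by (auto simp flip: add_mult_distrib)
  then show "fract_deriv i a h * fract_deriv i (t - a) h' \<in>
      fractions_upto f n (j + j' + t) (e + e' + t * d)"
    using fractions_upto_mult [OF assms [THEN derivs_boundedD], of i a i "t - a"] by metis
qed

lemma derivs_bounded_to_fract: "g \<in> polys_upto n e \<Longrightarrow> derivs_bounded 0 e (to_fract g)"
  unfolding derivs_bounded_def fract_deriv_to_fract
  by (intro allI fractions_upto_raise fractions_upto_to_fract polys_upto_dpart)

lemma derivs_bounded_inverse: "derivs_bounded 1 0 (1 / to_fract f)"
  unfolding derivs_bounded_def
proof (intro allI)
  fix i t
  show "fract_deriv i t (1 / to_fract f) \<in> fractions_upto f n (1 + t) (0 + t * d)"
  proof (induction t rule: less_induct)
    case (less t)
    show ?case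
    proof (cases "t = 0")
      case True
      then show ?thesis
        using fractions_upto_inverse by simp
    next
      case False
      have "fract_deriv i a (to_fract f) * fract_deriv i (t - a) (1 / to_fract f)
          \<in> fractions_upto f n t (t * d)" if a: "a \<in> {1..t}" for a
      proof -
        have "fract_deriv i a (to_fract f) * fract_deriv i (t - a) (1 / to_fract f)
            \<in> fractions_upto f n (0 + (1 + (t - a))) (d + (0 + (t - a) * d))"
          using a unfolding fract_deriv_to_fract
          by (intro fractions_upto_mult fractions_upto_to_fract polys_upto_dpart f_degree less.IH)
            auto
        from fractions_upto_raise [OF this, of "a - 1"]
        have "fract_deriv i a (to_fract f) * fract_deriv i (t - a) (1 / to_fract f)
            \<in> fractions_upto f n (1 + (t - a) + (a - 1)) ((1 + (t - a) + (a - 1)) * d)"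
          by (simp add: algebra_simps)
        moreover have "1 + (t - a) + (a - 1) = t"
          using a by auto
        ultimately show ?thesis
          by (simp only:)
      qed
      then have "(1 / to_fract f) *
          - (\<Sum>a=1..t. fract_deriv i a (to_fract f) * fract_deriv i (t - a) (1 / to_fract f))
          \<in> fractions_upto f n (1 + t) (0 + t * d)"
        by (intro fractions_upto_mult fractions_upto_inverse fractions_upto_uminus
            fractions_upto_sum)
      then show ?thesis
        using fract_deriv_inverse [of "to_fract f" t i] f_nonzero False by simp
    qed
  qed
qed

lemma derivs_bounded_fractions_upto:
  assumes "v \<in> fractions_upto f n j e"
  shows "derivs_bounded j e v"
proof -
  obtain g where g: "g \<in> polys_upto n e" "v = to_fract g / to_fract f ^ j"
    using assms by (auto simp: fractions_upto_def)
  have "derivs_bounded j e (to_fract g * (1 / to_fract f) ^ j)"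
  proof (induction j)
    case 0
    show ?case using derivs_bounded_to_fract [OF g(1)] by simp
  next
    case (Suc j)
    then show ?case
      using derivs_bounded_mult [OF Suc derivs_bounded_inverse] by (simp add: mult_ac)
  qed
  then show ?thesis
    by (simp add: g(2) power_one_over)
qed

definition V :: "nat \<Rightarrow> 'k mpoly fract set" where
  "V j = fractions_upto f n j (j * (d + 1))"

sublocale filtered_dmodule fract_scale fract_deriv n V
proof
  show "mono V"
  proof (intro monoI subsetI)
    fix j j' :: nat and v assume "j \<le> j'" and v: "v \<in> V j"
    then obtain a where a: "j' = j + a"
      using le_Suc_ex by blast
    have "v \<in> fractions_upto f n (j + a) (j * (d + 1) + a * d)"
      using v unfolding V_def by (rule fractions_upto_raise)
    then show "v \<in> V j'"
      unfolding V_def a by (rule fractions_upto_mono) (simp add: algebra_simps)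
  qed
  show "fract_deriv i t v \<in> V (j + t)" if "v \<in> V j" for i t j v
  proof (unfold V_def, rule fractions_upto_mono)
    show "fract_deriv i t v \<in> fractions_upto f n (j + t) (j * (d + 1) + t * d)"
      using that unfolding V_def by (intro derivs_boundedD derivs_bounded_fractions_upto)
  qed (simp add: algebra_simps)
  show "fract_scale (single m 1) v \<in> V (j + monomial_degree m)"
    if m: "m \<in> monomials n" and v: "v \<in> V j" for m j v
  proof -
    have "fract_scale (single m 1) v
        \<in> fractions_upto f n (0 + j) (monomial_degree m + j * (d + 1))"
      using m v unfolding fract_scale_def V_def
      by (intro fractions_upto_mult fractions_upto_to_fract polys_upto_single)
        (simp add: monomials_upto_def)
    from fractions_upto_raise [OF this, of "monomial_degree m"] show ?thesis
      unfolding V_def by (simp add: algebra_simps)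
  qed
qed

lemma V_span:
  "V j \<subseteq> fract.vs.span
      ((\<lambda>m. to_fract (single m 1) / to_fract f ^ j) ` monomials_upto n ((d + 1) * j))"
    (is "_ \<subseteq> fract.vs.span ?T")
proof
  fix v assume "v \<in> V j"
  then obtain g where g: "g \<in> polys_upto n ((d + 1) * j)" "v = to_fract g / to_fract f ^ j"
    by (auto simp: V_def fractions_upto_def mult.commute)
  have "to_fract g = (\<Sum>m\<in>keys g. to_fract (single 0 (lookup g m)) * to_fract (single m 1))"
    by (subst poly_mapping_sum_single [of g])
      (simp add: to_fract_sum mult_single flip: to_fract_mult)
  then have "v = (\<Sum>m\<in>keys g.
      fract_scale (single 0 (lookup g m)) (to_fract (single m 1) / to_fract f ^ j))"
    by (simp add: g(2) fract_scale_def sum_divide_distrib)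
  also have "\<dots> \<in> fract.vs.span ?T"
    using g(1)
    by (intro fract.vs.span_sum fract.vs.span_scale fract.vs.span_base imageI)
      (auto simp: polys_upto_def)
  finally show "v \<in> fract.vs.span ?T" .
qed

theorem fract_chain_length_le:
  assumes "fract.dsubmodule_chain n N l" "N l \<subseteq> (\<Union>j. V j)"
  shows "l \<le> (d + 1) ^ n"
proof (rule dsubmodule_chain_length_le [OF assms])
  fix j
  let ?T = "(\<lambda>m. to_fract (single m 1) / to_fract f ^ j) ` monomials_upto n ((d + 1) * j)"
  show "finite ?T"
    by (intro finite_imageI finite_monomials_upto)
  show "V j \<subseteq> fract.vs.span ?T"
    by (rule V_span)
  have "card ?T \<le> card (monomials_upto n ((d + 1) * j))"
    by (rule card_image_le [OF finite_monomials_upto])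
  also have "\<dots> \<le> (d + 1) ^ n * card (monomials_upto n j)"
    by (rule card_monomials_upto_mult_le) simp
  finally show "card ?T \<le> (d + 1) ^ n * card (monomials_upto n j)" .
qed

end

section \<open>Representation by pairs\<close>

definition loc_fract :: "'k::field mpoly \<Rightarrow> 'k mpoly \<times> nat \<Rightarrow> 'k mpoly fract" where
  "loc_fract f p = to_fract (fst p) / to_fract f ^ snd p"

lemma loc_eq_iff_loc_fract: "f \<noteq> 0 \<Longrightarrow> loc_eq f p q \<longleftrightarrow> loc_fract f p = loc_fract f q"
  by (simp add: loc_eq_def loc_fract_def frac_eq_eq flip: to_fract_power to_fract_mult)

lemma loc_fract_loc_add: "f \<noteq> 0 \<Longrightarrow> loc_fract f (loc_add f p q) = loc_fract f p + loc_fract f q"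
  by (simp add: loc_fract_def loc_add_def to_fract_power power_add field_simps)

declare dloc_num.simps [simp del]

lemma to_fract_dloc_num:
  assumes "F \<noteq> 0"
  shows "to_fract (dloc_num i F g t) =
    to_fract F ^ (t + 1) * fract_deriv i t (to_fract g / to_fract F)"
proof (induction t rule: less_induct)
  case (less t)
  let ?h = "to_fract g / to_fract F"
  have "to_fract (dpart i t g) = fract_deriv i t (to_fract F * ?h)"
    using assms by (simp add: fract_deriv_to_fract)
  also have "\<dots> = to_fract F * fract_deriv i t ?h +
      (\<Sum>j=1..t. to_fract (dpart i j F) * fract_deriv i (t - j) ?h)"
    unfolding fract_deriv_mult_split by (simp add: fract_deriv_to_fract)
  finally have "to_fract F ^ t * to_fract (dpart i t g) =
      to_fract F ^ (t + 1) * fract_deriv i t ?h +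
      (\<Sum>j=1..t. to_fract F ^ t * (to_fract (dpart i j F) * fract_deriv i (t - j) ?h))"
    by (simp add: algebra_simps sum_distrib_left)
  moreover have "(\<Sum>j=1..t. to_fract F ^ t * (to_fract (dpart i j F) * fract_deriv i (t - j) ?h)) =
     (\<Sum>j=1..t. to_fract (dpart i j F) * to_fract F ^ (j - 1) * to_fract (dloc_num i F g (t - j)))"
  proof (intro sum.cong refl)
    fix j assume j: "j \<in> {1..t}"
    then have "t = (j - 1) + (t - j + 1)"
      by auto
    then have "to_fract F ^ t = to_fract F ^ (j - 1) * to_fract F ^ (t - j + 1)"
      by (metis power_add)
    then show "to_fract F ^ t * (to_fract (dpart i j F) * fract_deriv i (t - j) ?h) =
        to_fract (dpart i j F) * to_fract F ^ (j - 1) * to_fract (dloc_num i F g (t - j))"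
      using j less [of "t - j"] by (simp add: algebra_simps)
  qed
  ultimately show ?case
    by (subst dloc_num.simps) (simp add: to_fract_power to_fract_sum)
qed

lemma loc_fract_dact:
  assumes "f \<noteq> 0"
  shows "loc_fract f (dact f i t p) = fract_deriv i t (loc_fract f p)"
  using assms to_fract_dloc_num [of "f ^ snd p" i "fst p" t]
  by (simp add: loc_fract_def dact_def to_fract_power power_mult del: power_Suc mult_Suc_right)

lemma dsubmodD:
  assumes "dsubmod E f n M"
  shows dsubmod_fst_polys: "p \<in> M \<Longrightarrow> fst p \<in> polys n"
    and dsubmod_saturated: "p \<in> M \<Longrightarrow> q \<in> polys n \<times> UNIV \<Longrightarrow> E p q \<Longrightarrow> q \<in> M"
    and dsubmod_zero: "(0, 0) \<in> M"
    and dsubmod_add: "p \<in> M \<Longrightarrow> q \<in> M \<Longrightarrow> loc_add f p q \<in> M"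
    and dsubmod_mult: "a \<in> polys n \<Longrightarrow> p \<in> M \<Longrightarrow> (a * fst p, snd p) \<in> M"
    and dsubmod_dact: "i < n \<Longrightarrow> p \<in> M \<Longrightarrow> dact f i t p \<in> M"
  using assms [unfolded dsubmod_def] by (fastforce, blast+)

lemma dsubmodule_loc_fract_image:
  fixes f :: "'k::field mpoly"
  assumes f: "f \<noteq> 0" and M: "dsubmod E f n M"
  shows "fract.dsubmodule n (loc_fract f ` M)"
proof (rule fract.dsubmoduleI)
  show "0 \<in> loc_fract f ` M"
    using dsubmod_zero [OF M] by (rule image_eqI [rotated]) (simp add: loc_fract_def)
next
  fix u v assume "u \<in> loc_fract f ` M" "v \<in> loc_fract f ` M"
  then obtain p q where "p \<in> M" "q \<in> M" "u + v = loc_fract f (loc_add f p q)"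
    using loc_fract_loc_add [OF f] by auto
  then show "u + v \<in> loc_fract f ` M"
    using dsubmod_add [OF M] by blast
next
  fix a :: "'k mpoly" and v assume a: "a \<in> polys n" and "v \<in> loc_fract f ` M"
  then obtain p where "p \<in> M" "fract_scale a v = loc_fract f (a * fst p, snd p)"
    by (auto simp: fract_scale_def loc_fract_def)
  then show "fract_scale a v \<in> loc_fract f ` M"
    using dsubmod_mult [OF M a] by blast
next
  fix i t v assume i: "i < n" and "v \<in> loc_fract f ` M"
  then obtain p where "p \<in> M" "fract_deriv i t v = loc_fract f (dact f i t p)"
    using loc_fract_dact [OF f] by auto
  then show "fract_deriv i t v \<in> loc_fract f ` M"
    using dsubmod_dact [OF M i] by blast
qed

lemma loc_fract_image_strict:
  assumes f: "f \<noteq> 0" and M: "dsubmod (loc_eq f) f n M" "dsubmod E f n M'" and "M \<subset> M'"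
  shows "loc_fract f ` M \<subset> loc_fract f ` M'"
proof -
  obtain p where p: "p \<in> M'" "p \<notin> M"
    using \<open>M \<subset> M'\<close> by blast
  have "loc_fract f p \<notin> loc_fract f ` M"
  proof
    assume "loc_fract f p \<in> loc_fract f ` M"
    then obtain q where "q \<in> M" "loc_eq f q p"
      using f by (auto simp: loc_eq_iff_loc_fract)
    then show False
      using dsubmod_saturated [OF M(1), of q p] dsubmod_fst_polys [OF M(2) p(1)] p(2)
      by (auto simp: mem_Times_iff)
  qed
  with p \<open>M \<subset> M'\<close> show ?thesis
    by blast
qed

lemma hloc_eq_of_loc_eq: "loc_eq f p q \<Longrightarrow> hloc_eq f n p q"
  unfolding hloc_eq_def loc_eq_def by (intro bexI [of _ 0]) auto

lemma dsubmod_loc_eq_of_hloc_eq: "dsubmod (hloc_eq f n) f n M \<Longrightarrow> dsubmod (loc_eq f) f n M"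
  unfolding dsubmod_def using hloc_eq_of_loc_eq by meson

lemma one_in_dsubmod_hloc_eq:
  assumes "dsubmod (hloc_eq f n) f n M"
  shows "(1, 0) \<in> M"
proof -
  have "hloc_eq f n (0, 0) (1, 0)"
    unfolding hloc_eq_def by (intro bexI [of _ "- 1"]) (auto simp: loc_eq_def polys_uminus)
  then show ?thesis
    using dsubmod_saturated [OF assms dsubmod_zero [OF assms]] by simp
qed

lemma dsubmod_loc_eq_zero:
  assumes "dsubmod (loc_eq 0) 0 n M"
  shows "M = polys n \<times> UNIV"
proof -
  have "loc_eq 0 p q" for p q :: "'a mpoly \<times> nat"
    unfolding loc_eq_def by (intro exI [of _ 1]) simp
  then show ?thesis
    using dsubmod_saturated [OF assms dsubmod_zero [OF assms]] dsubmod_fst_polys [OF assms] by auto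
qed

definition dsubmod_chain ::
    "('k::field mpoly \<times> nat \<Rightarrow> 'k mpoly \<times> nat \<Rightarrow> bool) \<Rightarrow> 'k mpoly \<Rightarrow> nat
       \<Rightarrow> (nat \<Rightarrow> ('k mpoly \<times> nat) set) \<Rightarrow> nat \<Rightarrow> bool" where
  "dsubmod_chain E f n N l \<longleftrightarrow> (\<forall>j\<le>l. dsubmod E f n (N j)) \<and> (\<forall>j<l. N j \<subset> N (Suc j))"

lemma dlength_le:
  assumes "\<And>N l. dsubmod_chain E f n N l \<Longrightarrow> l \<le> b"
  shows "dlength E f n \<le> enat b"
  unfolding dlength_def by (rule Sup_least) (use assms in \<open>auto simp: dsubmod_chain_def\<close>)

lemma dsubmod_chain_loc_eq_of_hloc_eq:
  "dsubmod_chain (hloc_eq f n) f n N l \<Longrightarrow> dsubmod_chain (loc_eq f) f n N l"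
  unfolding dsubmod_chain_def using dsubmod_loc_eq_of_hloc_eq by blast

lemma dsubmod_chain_zero:
  assumes "dsubmod_chain (loc_eq 0) 0 n N l"
  shows "l = 0"
proof (rule ccontr)
  assume "l \<noteq> 0"
  then have "N 0 = polys n \<times> UNIV" "N 1 = polys n \<times> UNIV" "N 0 \<subset> N 1"
    using assms by (auto simp: dsubmod_chain_def intro!: dsubmod_loc_eq_zero)
  then show False
    by simp
qed

lemma dsubmodule_chain_loc_fract:
  assumes "f \<noteq> 0" "dsubmod_chain (loc_eq f) f n N l"
  shows "fract.dsubmodule_chain n (\<lambda>j. loc_fract f ` N j) l"
  using assms unfolding dsubmod_chain_def fract.dsubmodule_chain_def
  by (meson Suc_leI dsubmodule_loc_fract_image less_imp_le loc_fract_image_strict)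

lemma (in localization) loc_fract_image_subset_V:
  assumes "dsubmod E f n M"
  shows "loc_fract f ` M \<subseteq> (\<Union>j. V j)"
proof (rule image_subsetI)
  fix p assume "p \<in> M"
  then obtain e where "fst p \<in> polys_upto n e"
    using dsubmod_fst_polys [OF assms] polys_iff_polys_upto by blast
  then have "loc_fract f p \<in> fractions_upto f n (snd p) e"
    by (auto simp: fractions_upto_def loc_fract_def)
  then have "loc_fract f p \<in> fractions_upto f n (snd p + e) (e + e * d)"
    by (rule fractions_upto_raise)
  then have "loc_fract f p \<in> V (snd p + e)"
    unfolding V_def by (rule fractions_upto_mono) (simp add: algebra_simps)
  then show "loc_fract f p \<in> (\<Union>j. V j)"
    by blast
qed

lemma loc_chain_length_le:
  assumes f: "f \<in> polys n" and chain: "dsubmod_chain (loc_eq f) f n N l"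
  shows "l \<le> (total_deg f + 1) ^ n"
proof (cases "f = 0")
  case True
  have "l = 0"
    using chain unfolding True by (rule dsubmod_chain_zero)
  then show ?thesis
    by simp
next
  case False
  interpret localization f n "total_deg f"
    using False polys_upto_total_deg [OF f] by unfold_locales
  show ?thesis
    using dsubmodule_chain_loc_fract [OF False chain]
  proof (rule fract_chain_length_le)
    show "loc_fract f ` N l \<subseteq> (\<Union>j. V j)"
      using chain by (intro loc_fract_image_subset_V [of "loc_eq f"]) (simp add: dsubmod_chain_def)
  qed
qed

lemma hloc_chain_length_less:
  assumes f: "f \<in> polys n" and chain: "dsubmod_chain (hloc_eq f n) f n N l"
  shows "l < (total_deg f + 1) ^ n"
proof (cases "f = 0")
  case True
  have "l = 0"
    using dsubmod_chain_loc_eq_of_hloc_eq [OF chain] unfolding True by (rule dsubmod_chain_zero)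
  then show ?thesis
    by simp
next
  case False
  interpret localization f n "total_deg f"
    using False polys_upto_total_deg [OF f] by unfold_locales
  let ?N = "\<lambda>j. loc_fract f ` N j"
  have N: "dsubmod (hloc_eq f n) f n (N j)" if "j \<le> l" for j
    using chain that by (simp add: dsubmod_chain_def)
  have "1 \<in> ?N 0"
    by (rule image_eqI [OF _ one_in_dsubmod_hloc_eq [OF N]]) (simp_all add: loc_fract_def)
  then have "?N 0 \<noteq> {0}"
    by (metis singletonD zero_neq_one)
  then have "fract.dsubmodule_chain n (case_nat {0} ?N) (Suc l)"
    using dsubmodule_chain_loc_fract [OF False dsubmod_chain_loc_eq_of_hloc_eq [OF chain]]
    by (intro fract.dsubmodule_chain_prepend_zero)
  moreover have "case_nat {0} ?N (Suc l) \<subseteq> (\<Union>j. V j)"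
    using loc_fract_image_subset_V [OF N] by simp
  ultimately have "Suc l \<le> (total_deg f + 1) ^ n"
    by (rule fract_chain_length_le)
  then show ?thesis
    by simp
qed

theorem theorem3p5:
  fixes f :: "'k::field mpoly" and n :: nat
  assumes "f \<in> polys n"
  shows "dlength (loc_eq f) f n \<le> enat ((total_deg f + 1) ^ n)
       \<and> dlength (hloc_eq f n) f n \<le> enat ((total_deg f + 1) ^ n - 1)"
proof
  show "dlength (loc_eq f) f n \<le> enat ((total_deg f + 1) ^ n)"
    using loc_chain_length_le [OF assms] by (rule dlength_le)
  have "l \<le> (total_deg f + 1) ^ n - 1" if "dsubmod_chain (hloc_eq f n) f n N l" for N l
    using hloc_chain_length_less [OF assms that] by simp
  then show "dlength (hloc_eq f n) f n \<le> enat ((total_deg f + 1) ^ n - 1)"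
    by (rule dlength_le)
qed

end
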